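(* For every $s\geqslant0$ and every formula $\psi$ of $BT_s$: if $BT_s^{cl}\vdash\psi$, then $BT_s\vdash\psi^-$.
   Context: $BT$ is the many-typed applicative theory with intuitionistic logic defined as follows. Types $\omega$ and $k\geqslant0$ ($\omega$ smallest). Variables: numerical $m,n,\ldots$ (type $\omega$), $X^k,Y^k,Z^k,\ldots$ of type $k$; type-$0$ variables also written $x,y,z,f,g,u,v$. Constants: $0$ (numerical), type-0 constants $\underline{k},\underline{s},\underline{d},\underline{p},\underline{p}_1,\underline{p}_2,\underline{c}_n$ $(n\geqslant0)$. No function symbols. Predicates: $Ap(f,x,y)$, $x=_{0\omega}m$, $x=_{0k}Y^k$, $X^k\in_kY^{k+1}$. Formulas built from atomic ones and $\bot$ by $\wedge,\vee,\supset,\forall,\exists$; $\neg\varphi:=\varphi\supset\bot$. A formula is $n$-elementary if it contains only types $\leqslant n$, no quantifier over type-$n$ variables and no $=_{0n}$. External terms: constants, variables, and applications $t\tau$ (left-associated). $t\simeq x$ is $x=_{0s}t$ for $t$ a constant/variable of type $s$, and $\exists y,z(t_1\simeq y\wedge t_2\simeq z\wedge Ap(y,z,x))$ for $t=t_1t_2$; $t\downarrow:=\exists x(t\simeq x)$, $t\simeq\tau:=\exists x(t\simeq x\wedge\tau\simeq x)$, $t\cong\tau:=\forall x(t\simeq x\equiv\tau\simeq x)$; $\tau(t_1,\ldots,t_n)$ means $\tau\langle t_1,\ldots,t_n\rangle$ with $\langle x_1\rangle=x_1$, $\langle x_1,\ldots,x_{n+1}\rangle=\underline{p}\langle x_1,\ldots,x_n\rangle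 x_{n+1}$. Axioms: (1) intuitionistic logic; (2) equality: $x=_{00}x$; $u=_{0k}X^k\wedge v=_{0k}X\wedge u=_{0n}Y^n\supset v=_{0n}Y$; $u=_{0\omega}m\wedge v=_{0\omega}m\supset u=_{00}v$; $u=_{0\omega}m\wedge u=_{00}v\supset v=_{0\omega}m$; $Ap(f,x,y)\wedge f=_{00}g\wedge x=_{00}u\wedge y=_{00}v\supset Ap(g,u,v)$; $X^k\in_kY^{k+1}\wedge X^k=_kU^k\wedge Y^{k+1}=_{k+1}Z^{k+1}\supset U\in_kZ$; (3) combinatorial: $Ap(f,x,y)\wedge Ap(f,x,z)\supset y=z$; $\underline{k}xy\simeq x$; $\underline{s}xy\downarrow$; $\underline{s}xyz\cong xz(yz)$; $\underline{p}xy\downarrow$; $\neg(\underline{p}xy\simeq0)$; $\underline{p}_ix\downarrow$; $\underline{p}_i(\underline{p}x_1x_2)\simeq x_i$; $\exists m(\underline{p}n0\simeq m)$; $\exists Z^k(\underline{p}xY^k\simeq Z)$; $n=m\supset\underline{d}xynm\simeq x$; $n\neq m\supset\underline{d}xynm\simeq y$; $\exists x(x=_{0\omega}n)$; $\exists x(x=_{0k}Y^k)$; (4) induction rule: from $\varphi[n/0]$ and $\varphi\supset\exists m(\underline{p}n0\simeq m\wedge\varphi[n/m])$ infer $\varphi$; (5) comprehension: $\exists U^{k+1}[\underline{c}_n(\widetilde X)\simeq U\wedge\forall Z^k(Z\in_kU\equiv\varphi)]$ for $\widetilde X$ a list of variables of types $\leqslant k+1$, $\varphi$ $(k+1)$-elementary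 with parameters among $Z^k,\widetilde X$, and $n$ the Gödel number of $Z^k.\widetilde X.\varphi$. $BT_s$ is the fragment with types $\leqslant s$ only; $BT_s^{cl}$ is $BT_s$ with classical logic. Negative translation $^-$ (defined by simultaneous induction on Gödel numbers): for every constant $a$ other than a comprehension constant, $a^-:=a$. For a comprehension constant $\underline{c}_n$: if $n=\llcorner Z^k.\widetilde X.\varphi\lrcorner$ then $\underline{c}_n^-:=\underline{c}_{n^-}$ with $n^-:=\llcorner Z^k.\widetilde X.\varphi^-\lrcorner$; otherwise $\underline{c}_n^-:=0$. For formulas: if $\varphi$ is atomic, $\varphi^-:=\neg\neg\tilde\varphi$ where $\tilde\varphi$ replaces each constant $a$ by $a^-$; $\bot^-:=\bot$; $(\psi\wedge\chi)^-:=\psi^-\wedge\chi^-$; $(\psi\supset\chi)^-:=\psi^-\supset\chi^-$; $(\psi\vee\chi)^-:=\neg\neg(\psi^-\vee\chi^-)$; $(\forall X\psi)^-:=\forall X\psi^-$; $(\exists X\psi)^-:=\neg\neg\exists X\psi^-$ for a variable $X$ of any type.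
   Formalization: Where a comprehension constant c_n with n not a Gödel number is translated to the numerical constant 0, the atomic formula A(0) is ill-typed as written; it is read as ∃v(v =_{0ω} 0 ∧ A(v)) with v a fresh type-0 variable. All other formulas are translated literally. *)

theory Defs
  imports Main "HOL-Library.Nat_Bijection"
begin

section \<open>Language\<close>

datatype ty = Om | Ty nat

fun ty_le :: "ty \<Rightarrow> nat \<Rightarrow> bool" where
  "ty_le Om n = True"
| "ty_le (Ty k) n = (k \<le> n)"

type_synonym var = "ty \<times> nat"

datatype const = Zero | cK | cS | cD | cP | cP1 | cP2 | cC nat

datatype trm = V var | Cst const

fun tyof :: "trm \<Rightarrow> ty" where
  "tyof (V x) = fst x"
| "tyof (Cst a) = (if a = Zero then Om else Ty 0)"

text \<open>\<open>Eq t a b\<close> is \<open>a =\<^sub>0\<^sub>t b\<close>, with \<open>a\<close> of type \<open>0\<close> and \<open>b\<close> of type \<open>t\<close>;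
  \<open>Mem k a b\<close> is membership of \<open>a\<close> of type \<open>k\<close> in \<open>b\<close> of type \<open>k + 1\<close>. The datatype contains
  ill-sorted expressions too; the formulas are singled out by \<open>fm_in\<close> below.\<close>

datatype fm =
    Ap trm trm trm
  | Eq ty trm trm
  | Mem nat trm trm
  | FBot
  | FAnd fm fm (infixr "\<^bold>\<and>" 35)
  | FOr fm fm (infixr "\<^bold>\<or>" 30)
  | FImp fm fm (infixr "\<^bold>\<longrightarrow>" 25)
  | FAll var fm
  | FEx var fm

abbreviation FNot :: "fm \<Rightarrow> fm" where
  "FNot \<phi> \<equiv> \<phi> \<^bold>\<longrightarrow> FBot"

abbreviation FIff :: "fm \<Rightarrow> fm \<Rightarrow> fm" (infix "\<^bold>\<longleftrightarrow>" 25) where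
  "\<phi> \<^bold>\<longleftrightarrow> \<psi> \<equiv> (\<phi> \<^bold>\<longrightarrow> \<psi>) \<^bold>\<and> (\<psi> \<^bold>\<longrightarrow> \<phi>)"

text \<open>\<open>fm_in s \<phi>\<close>: \<open>\<phi>\<close> is a (well-sorted) formula containing only types \<open>\<le> s\<close>.\<close>

fun fm_in :: "nat \<Rightarrow> fm \<Rightarrow> bool" where
  "fm_in s (Ap a b c) \<longleftrightarrow> tyof a = Ty 0 \<and> tyof b = Ty 0 \<and> tyof c = Ty 0"
| "fm_in s (Eq t a b) \<longleftrightarrow> ty_le t s \<and> tyof a = Ty 0 \<and> tyof b = t"
| "fm_in s (Mem k a b) \<longleftrightarrow> Suc k \<le> s \<and> tyof a = Ty k \<and> tyof b = Ty (Suc k)"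
| "fm_in s FBot \<longleftrightarrow> True"
| "fm_in s (\<phi> \<^bold>\<and> \<psi>) \<longleftrightarrow> fm_in s \<phi> \<and> fm_in s \<psi>"
| "fm_in s (\<phi> \<^bold>\<or> \<psi>) \<longleftrightarrow> fm_in s \<phi> \<and> fm_in s \<psi>"
| "fm_in s (\<phi> \<^bold>\<longrightarrow> \<psi>) \<longleftrightarrow> fm_in s \<phi> \<and> fm_in s \<psi>"
| "fm_in s (FAll x \<phi>) \<longleftrightarrow> ty_le (fst x) s \<and> fm_in s \<phi>"
| "fm_in s (FEx x \<phi>) \<longleftrightarrow> ty_le (fst x) s \<and> fm_in s \<phi>"

fun no_top :: "nat \<Rightarrow> fm \<Rightarrow> bool" where
  "no_top n (Ap a b c) \<longleftrightarrow> True"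
| "no_top n (Eq t a b) \<longleftrightarrow> t \<noteq> Ty n"
| "no_top n (Mem k a b) \<longleftrightarrow> True"
| "no_top n FBot \<longleftrightarrow> True"
| "no_top n (\<phi> \<^bold>\<and> \<psi>) \<longleftrightarrow> no_top n \<phi> \<and> no_top n \<psi>"
| "no_top n (\<phi> \<^bold>\<or> \<psi>) \<longleftrightarrow> no_top n \<phi> \<and> no_top n \<psi>"
| "no_top n (\<phi> \<^bold>\<longrightarrow> \<psi>) \<longleftrightarrow> no_top n \<phi> \<and> no_top n \<psi>"
| "no_top n (FAll x \<phi>) \<longleftrightarrow> fst x \<noteq> Ty n \<and> no_top n \<phi>"
| "no_top n (FEx x \<phi>) \<longleftrightarrow> fst x \<noteq> Ty n \<and> no_top n \<phi>"

definition elementary :: "nat \<Rightarrow> fm \<Rightarrow> bool" where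
  "elementary n \<phi> \<longleftrightarrow> fm_in n \<phi> \<and> no_top n \<phi>"

fun tv :: "trm \<Rightarrow> var set" where
  "tv (V x) = {x}"
| "tv (Cst a) = {}"

fun fv :: "fm \<Rightarrow> var set" where
  "fv (Ap a b c) = tv a \<union> tv b \<union> tv c"
| "fv (Eq t a b) = tv a \<union> tv b"
| "fv (Mem k a b) = tv a \<union> tv b"
| "fv FBot = {}"
| "fv (\<phi> \<^bold>\<and> \<psi>) = fv \<phi> \<union> fv \<psi>"
| "fv (\<phi> \<^bold>\<or> \<psi>) = fv \<phi> \<union> fv \<psi>"
| "fv (\<phi> \<^bold>\<longrightarrow> \<psi>) = fv \<phi> \<union> fv \<psi>"
| "fv (FAll x \<phi>) = fv \<phi> - {x}"
| "fv (FEx x \<phi>) = fv \<phi> - {x}"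

fun tsubst :: "var \<Rightarrow> trm \<Rightarrow> trm \<Rightarrow> trm" where
  "tsubst x t (V y) = (if y = x then t else V y)"
| "tsubst x t (Cst a) = Cst a"

text \<open>\<open>subst x t \<phi>\<close> replaces the free occurrences of \<open>x\<close> without renaming; it is only used together
  with \<open>free_for t x \<phi>\<close>, which excludes variable capture.\<close>

fun subst :: "var \<Rightarrow> trm \<Rightarrow> fm \<Rightarrow> fm" where
  "subst x t (Ap a b c) = Ap (tsubst x t a) (tsubst x t b) (tsubst x t c)"
| "subst x t (Eq r a b) = Eq r (tsubst x t a) (tsubst x t b)"
| "subst x t (Mem k a b) = Mem k (tsubst x t a) (tsubst x t b)"
| "subst x t FBot = FBot"
| "subst x t (\<phi> \<^bold>\<and> \<psi>) = (subst x t \<phi> \<^bold>\<and> subst x t \<psi>)"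
| "subst x t (\<phi> \<^bold>\<or> \<psi>) = (subst x t \<phi> \<^bold>\<or> subst x t \<psi>)"
| "subst x t (\<phi> \<^bold>\<longrightarrow> \<psi>) = (subst x t \<phi> \<^bold>\<longrightarrow> subst x t \<psi>)"
| "subst x t (FAll y \<phi>) = FAll y (if y = x then \<phi> else subst x t \<phi>)"
| "subst x t (FEx y \<phi>) = FEx y (if y = x then \<phi> else subst x t \<phi>)"

fun free_for :: "trm \<Rightarrow> var \<Rightarrow> fm \<Rightarrow> bool" where
  "free_for t x (\<phi> \<^bold>\<and> \<psi>) \<longleftrightarrow> free_for t x \<phi> \<and> free_for t x \<psi>"
| "free_for t x (\<phi> \<^bold>\<or> \<psi>) \<longleftrightarrow> free_for t x \<phi> \<and> free_for t x \<psi>"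
| "free_for t x (\<phi> \<^bold>\<longrightarrow> \<psi>) \<longleftrightarrow> free_for t x \<phi> \<and> free_for t x \<psi>"
| "free_for t x (FAll y \<phi>) \<longleftrightarrow> x \<notin> fv (FAll y \<phi>) \<or> (y \<notin> tv t \<and> free_for t x \<phi>)"
| "free_for t x (FEx y \<phi>) \<longleftrightarrow> x \<notin> fv (FEx y \<phi>) \<or> (y \<notin> tv t \<and> free_for t x \<phi>)"
| "free_for t x _ \<longleftrightarrow> True"

section \<open>External terms\<close>

datatype xt = T trm | XApp xt xt (infixl "\<bullet>" 70)

abbreviation xv :: "var \<Rightarrow> xt" where "xv x \<equiv> T (V x)"
abbreviation xc :: "const \<Rightarrow> xt" where "xc a \<equiv> T (Cst a)"

fun xfv :: "xt \<Rightarrow> var set" where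
  "xfv (T a) = tv a"
| "xfv (t \<bullet> u) = xfv t \<union> xfv u"

text \<open>A type-0 variable outside a given finite set, used for the bound variables of abbreviations.\<close>

definition new :: "var set \<Rightarrow> var" where
  "new A = (Ty 0, LEAST i. (Ty 0, i) \<notin> A)"

lemma fst_new [simp]: "fst (new A) = Ty 0"
  by (simp add: new_def)

lemma new_notin: "finite A \<Longrightarrow> new A \<notin> A"
proof -
  assume "finite A"
  hence "finite {i. (Ty 0, i) \<in> A}"
    by (rule finite_vimageI[of A "Pair (Ty 0)", unfolded vimage_def]) (simp add: inj_on_def)
  then obtain i where "(Ty 0, i) \<notin> A"
    using infinite_UNIV_nat by (metis (mono_tags, lifting) UNIV_eq_I mem_Collect_eq)
  thus ?thesis unfolding new_def by (rule LeastI)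
qed

lemma finite_tv [simp]: "finite (tv a)" by (cases a) auto
lemma finite_fv [simp]: "finite (fv \<phi>)" by (induction \<phi>) auto
lemma finite_xfv [simp]: "finite (xfv t)" by (induction t) auto

text \<open>\<open>ev t x\<close> is \<open>t \<simeq> x\<close> for a type-0 variable \<open>x\<close>; \<open>sim t u\<close> is \<open>t \<simeq> u\<close> for external terms.\<close>

fun ev :: "xt \<Rightarrow> var \<Rightarrow> fm" where
  "ev (T a) x = Eq (tyof a) (V x) a"
| "ev (t \<bullet> u) x =
    (let A = xfv t \<union> xfv u \<union> {x}; y = new A; z = new (insert y A)
     in FEx y (FEx z (ev t y \<^bold>\<and> ev u z \<^bold>\<and> Ap (V y) (V z) (V x))))"

definition defd :: "xt \<Rightarrow> fm" where
  "defd t = (let x = new (xfv t) in FEx x (ev t x))"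

definition sim :: "xt \<Rightarrow> xt \<Rightarrow> fm" where
  "sim t u = (let x = new (xfv t \<union> xfv u) in FEx x (ev t x \<^bold>\<and> ev u x))"

definition cong :: "xt \<Rightarrow> xt \<Rightarrow> fm" where
  "cong t u = (let x = new (xfv t \<union> xfv u) in FAll x (ev t x \<^bold>\<longleftrightarrow> ev u x))"

text \<open>Equality between two variables of the same type (\<open>n = m\<close> and \<open>X =\<^sub>k U\<close>), which is not primitive.\<close>

abbreviation eqv :: "var \<Rightarrow> var \<Rightarrow> fm" where
  "eqv X U \<equiv> sim (xv X) (xv U)"

text \<open>\<open>xapp t us\<close> is \<open>t(u\<^sub>1, \<dots>, u\<^sub>n)\<close>, and just \<open>t\<close> if the list is empty.\<close>

fun xapp :: "xt \<Rightarrow> xt list \<Rightarrow> xt" where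
  "xapp t [] = t"
| "xapp t (u # us) = t \<bullet> foldl (\<lambda>a b. xc cP \<bullet> a \<bullet> b) u us"

section \<open>Goedel numbers\<close>

fun ty_code :: "ty \<Rightarrow> nat" where
  "ty_code Om = 0"
| "ty_code (Ty k) = Suc k"

fun var_code :: "var \<Rightarrow> nat" where
  "var_code (t, i) = prod_encode (ty_code t, i)"

fun const_code :: "const \<Rightarrow> nat" where
  "const_code Zero = 0"
| "const_code cK = 1"
| "const_code cS = 2"
| "const_code cD = 3"
| "const_code cP = 4"
| "const_code cP1 = 5"
| "const_code cP2 = 6"
| "const_code (cC n) = 7 + n"

fun trm_code :: "trm \<Rightarrow> nat" where
  "trm_code (V x) = 2 * var_code x"
| "trm_code (Cst a) = 2 * const_code a + 1"

fun fm_code :: "fm \<Rightarrow> nat" where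
  "fm_code (Ap a b c) =
     prod_encode (0, prod_encode (trm_code a, prod_encode (trm_code b, trm_code c)))"
| "fm_code (Eq t a b) =
     prod_encode (1, prod_encode (ty_code t, prod_encode (trm_code a, trm_code b)))"
| "fm_code (Mem k a b) =
     prod_encode (2, prod_encode (k, prod_encode (trm_code a, trm_code b)))"
| "fm_code FBot = prod_encode (3, 0)"
| "fm_code (\<phi> \<^bold>\<and> \<psi>) = prod_encode (4, prod_encode (fm_code \<phi>, fm_code \<psi>))"
| "fm_code (\<phi> \<^bold>\<or> \<psi>) = prod_encode (5, prod_encode (fm_code \<phi>, fm_code \<psi>))"
| "fm_code (\<phi> \<^bold>\<longrightarrow> \<psi>) = prod_encode (6, prod_encode (fm_code \<phi>, fm_code \<psi>))"
| "fm_code (FAll x \<phi>) = prod_encode (7, prod_encode (var_code x, fm_code \<phi>))"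
| "fm_code (FEx x \<phi>) = prod_encode (8, prod_encode (var_code x, fm_code \<phi>))"

text \<open>The Goedel number of \<open>Z.X\<^sub>1\<dots>X\<^sub>n.\<phi>\<close>.\<close>

definition gn :: "var \<Rightarrow> var list \<Rightarrow> fm \<Rightarrow> nat" where
  "gn Z Xs \<phi> = prod_encode (var_code Z, prod_encode (list_encode (map var_code Xs), fm_code \<phi>))"

lemma ty_code_inj: "ty_code t = ty_code u \<Longrightarrow> t = u"
  by (cases t; cases u) auto

lemma var_code_inj: "var_code x = var_code y \<Longrightarrow> x = y"
  by (cases x; cases y) (auto dest: ty_code_inj)

lemma const_code_inj: "const_code a = const_code b \<Longrightarrow> a = b"
  by (cases a; cases b) auto

lemma trm_code_inj: "trm_code a = trm_code b \<Longrightarrow> a = b"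
proof (cases a; cases b)
  fix x y assume "trm_code a = trm_code b" "a = V x" "b = V y"
  thus ?thesis by (auto dest: var_code_inj)
next
  fix x c assume "trm_code a = trm_code b" "a = V x" "b = Cst c"
  hence "2 * var_code x = 2 * const_code c + 1" by simp
  hence False by presburger
  thus ?thesis ..
next
  fix x c assume "trm_code a = trm_code b" "a = Cst c" "b = V x"
  hence "2 * var_code x = 2 * const_code c + 1" by simp
  hence False by presburger
  thus ?thesis ..
next
  fix c d assume "trm_code a = trm_code b" "a = Cst c" "b = Cst d"
  thus ?thesis by (auto dest: const_code_inj)
qed

lemma fm_code_inj: "fm_code \<phi> = fm_code \<psi> \<Longrightarrow> \<phi> = \<psi>"
proof (induction \<phi> arbitrary: \<psi>)
  case (Ap a b c) thus ?case by (cases \<psi>) (auto dest: trm_code_inj)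
next
  case (Eq t a b) thus ?case by (cases \<psi>) (auto dest: trm_code_inj ty_code_inj)
next
  case (Mem k a b) thus ?case by (cases \<psi>) (auto dest: trm_code_inj)
next
  case FBot thus ?case by (cases \<psi>) auto
next
  case (FAnd \<phi>1 \<phi>2) thus ?case by (cases \<psi>) auto
next
  case (FOr \<phi>1 \<phi>2) thus ?case by (cases \<psi>) auto
next
  case (FImp \<phi>1 \<phi>2) thus ?case by (cases \<psi>) auto
next
  case (FAll x \<phi>) thus ?case by (cases \<psi>) (auto simp del: var_code.simps dest: var_code_inj)
next
  case (FEx x \<phi>) thus ?case by (cases \<psi>) (auto simp del: var_code.simps dest: var_code_inj)
qed

lemma gn_inj: "gn Z Xs \<phi> = gn Z' Xs' \<phi>' \<longleftrightarrow> Z = Z' \<and> Xs = Xs' \<and> \<phi> = \<phi>'"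
proof -
  have "inj var_code" by (rule injI) (rule var_code_inj)
  thus ?thesis
    unfolding gn_def
    by (auto dest: var_code_inj fm_code_inj simp: list_encode_eq inj_map_eq_map
        simp del: var_code.simps)
qed

section \<open>The theories\<close>

inductive logic_axiom :: "fm \<Rightarrow> bool" where
  K: "logic_axiom (\<phi> \<^bold>\<longrightarrow> \<psi> \<^bold>\<longrightarrow> \<phi>)"
| S: "logic_axiom ((\<phi> \<^bold>\<longrightarrow> \<psi> \<^bold>\<longrightarrow> \<chi>) \<^bold>\<longrightarrow> (\<phi> \<^bold>\<longrightarrow> \<psi>) \<^bold>\<longrightarrow> \<phi> \<^bold>\<longrightarrow> \<chi>)"
| AndI: "logic_axiom (\<phi> \<^bold>\<longrightarrow> \<psi> \<^bold>\<longrightarrow> (\<phi> \<^bold>\<and> \<psi>))"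
| AndE1: "logic_axiom ((\<phi> \<^bold>\<and> \<psi>) \<^bold>\<longrightarrow> \<phi>)"
| AndE2: "logic_axiom ((\<phi> \<^bold>\<and> \<psi>) \<^bold>\<longrightarrow> \<psi>)"
| OrI1: "logic_axiom (\<phi> \<^bold>\<longrightarrow> (\<phi> \<^bold>\<or> \<psi>))"
| OrI2: "logic_axiom (\<psi> \<^bold>\<longrightarrow> (\<phi> \<^bold>\<or> \<psi>))"
| OrE: "logic_axiom ((\<phi> \<^bold>\<longrightarrow> \<chi>) \<^bold>\<longrightarrow> (\<psi> \<^bold>\<longrightarrow> \<chi>) \<^bold>\<longrightarrow> (\<phi> \<^bold>\<or> \<psi>) \<^bold>\<longrightarrow> \<chi>)"
| BotE: "logic_axiom (FBot \<^bold>\<longrightarrow> \<phi>)"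
| AllE: "tyof t = fst x \<Longrightarrow> free_for t x \<phi> \<Longrightarrow> logic_axiom (FAll x \<phi> \<^bold>\<longrightarrow> subst x t \<phi>)"
| ExI: "tyof t = fst x \<Longrightarrow> free_for t x \<phi> \<Longrightarrow> logic_axiom (subst x t \<phi> \<^bold>\<longrightarrow> FEx x \<phi>)"

text \<open>In the axioms below \<open>f, x, y, z, u, v\<close> are variables of type \<open>0\<close>, \<open>n, m\<close> are numerical variables
  and \<open>X, Y, Z, U\<close> are variables of the indicated types; variables that need not be different may
  coincide.\<close>

inductive equality_axiom :: "fm \<Rightarrow> bool" where
  refl: "fst x = Ty 0 \<Longrightarrow> equality_axiom (Eq (Ty 0) (V x) (V x))"
| eq_eq: "fst u = Ty 0 \<Longrightarrow> fst v = Ty 0 \<Longrightarrow> fst X = Ty k \<Longrightarrow> fst Y = Ty n \<Longrightarrow>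
    equality_axiom (Eq (Ty k) (V u) (V X) \<^bold>\<and> Eq (Ty k) (V v) (V X) \<^bold>\<and> Eq (Ty n) (V u) (V Y)
      \<^bold>\<longrightarrow> Eq (Ty n) (V v) (V Y))"
| num_eq: "fst u = Ty 0 \<Longrightarrow> fst v = Ty 0 \<Longrightarrow> fst m = Om \<Longrightarrow>
    equality_axiom (Eq Om (V u) (V m) \<^bold>\<and> Eq Om (V v) (V m) \<^bold>\<longrightarrow> Eq (Ty 0) (V u) (V v))"
| eq_num: "fst u = Ty 0 \<Longrightarrow> fst v = Ty 0 \<Longrightarrow> fst m = Om \<Longrightarrow>
    equality_axiom (Eq Om (V u) (V m) \<^bold>\<and> Eq (Ty 0) (V u) (V v) \<^bold>\<longrightarrow> Eq Om (V v) (V m))"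
| eq_Ap: "\<forall>w \<in> {f, x, y, g, u, v}. fst w = Ty 0 \<Longrightarrow>
    equality_axiom (Ap (V f) (V x) (V y) \<^bold>\<and> Eq (Ty 0) (V f) (V g) \<^bold>\<and> Eq (Ty 0) (V x) (V u)
      \<^bold>\<and> Eq (Ty 0) (V y) (V v) \<^bold>\<longrightarrow> Ap (V g) (V u) (V v))"
| eq_Mem: "fst X = Ty k \<Longrightarrow> fst U = Ty k \<Longrightarrow> fst Y = Ty (Suc k) \<Longrightarrow> fst Z = Ty (Suc k) \<Longrightarrow>
    equality_axiom (Mem k (V X) (V Y) \<^bold>\<and> eqv X U \<^bold>\<and> eqv Y Z \<^bold>\<longrightarrow> Mem k (V U) (V Z))"

inductive combinatory_axiom :: "fm \<Rightarrow> bool" where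
  Ap_fun: "\<forall>w \<in> {f, x, y, z}. fst w = Ty 0 \<Longrightarrow>
    combinatory_axiom (Ap (V f) (V x) (V y) \<^bold>\<and> Ap (V f) (V x) (V z) \<^bold>\<longrightarrow> Eq (Ty 0) (V y) (V z))"
| k: "fst x = Ty 0 \<Longrightarrow> fst y = Ty 0 \<Longrightarrow> combinatory_axiom (ev (xc cK \<bullet> xv x \<bullet> xv y) x)"
| s_defd: "fst x = Ty 0 \<Longrightarrow> fst y = Ty 0 \<Longrightarrow> combinatory_axiom (defd (xc cS \<bullet> xv x \<bullet> xv y))"
| s: "fst x = Ty 0 \<Longrightarrow> fst y = Ty 0 \<Longrightarrow> fst z = Ty 0 \<Longrightarrow>
    combinatory_axiom (cong (xc cS \<bullet> xv x \<bullet> xv y \<bullet> xv z) (xv x \<bullet> xv z \<bullet> (xv y \<bullet> xv z)))"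
| p_defd: "fst x = Ty 0 \<Longrightarrow> fst y = Ty 0 \<Longrightarrow> combinatory_axiom (defd (xc cP \<bullet> xv x \<bullet> xv y))"
| p_nonzero: "fst x = Ty 0 \<Longrightarrow> fst y = Ty 0 \<Longrightarrow>
    combinatory_axiom (FNot (sim (xc cP \<bullet> xv x \<bullet> xv y) (xc Zero)))"
| p1_defd: "fst x = Ty 0 \<Longrightarrow> combinatory_axiom (defd (xc cP1 \<bullet> xv x))"
| p2_defd: "fst x = Ty 0 \<Longrightarrow> combinatory_axiom (defd (xc cP2 \<bullet> xv x))"
| p1: "fst x = Ty 0 \<Longrightarrow> fst y = Ty 0 \<Longrightarrow>
    combinatory_axiom (ev (xc cP1 \<bullet> (xc cP \<bullet> xv x \<bullet> xv y)) x)"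
| p2: "fst x = Ty 0 \<Longrightarrow> fst y = Ty 0 \<Longrightarrow>
    combinatory_axiom (ev (xc cP2 \<bullet> (xc cP \<bullet> xv x \<bullet> xv y)) y)"
| p_num: "fst n = Om \<Longrightarrow> fst m = Om \<Longrightarrow> m \<noteq> n \<Longrightarrow>
    combinatory_axiom (FEx m (sim (xc cP \<bullet> xv n \<bullet> xc Zero) (xv m)))"
| p_type: "fst x = Ty 0 \<Longrightarrow> fst Y = Ty k \<Longrightarrow> fst Z = Ty k \<Longrightarrow> Z \<noteq> x \<Longrightarrow> Z \<noteq> Y \<Longrightarrow>
    combinatory_axiom (FEx Z (sim (xc cP \<bullet> xv x \<bullet> xv Y) (xv Z)))"
| d_eq: "fst x = Ty 0 \<Longrightarrow> fst y = Ty 0 \<Longrightarrow> fst n = Om \<Longrightarrow> fst m = Om \<Longrightarrow>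
    combinatory_axiom (eqv n m \<^bold>\<longrightarrow> ev (xc cD \<bullet> xv x \<bullet> xv y \<bullet> xv n \<bullet> xv m) x)"
| d_neq: "fst x = Ty 0 \<Longrightarrow> fst y = Ty 0 \<Longrightarrow> fst n = Om \<Longrightarrow> fst m = Om \<Longrightarrow>
    combinatory_axiom (FNot (eqv n m) \<^bold>\<longrightarrow> ev (xc cD \<bullet> xv x \<bullet> xv y \<bullet> xv n \<bullet> xv m) y)"
| num_obj: "fst x = Ty 0 \<Longrightarrow> fst n = Om \<Longrightarrow> combinatory_axiom (FEx x (Eq Om (V x) (V n)))"
| type_obj: "fst x = Ty 0 \<Longrightarrow> fst Y = Ty k \<Longrightarrow> x \<noteq> Y \<Longrightarrow>
    combinatory_axiom (FEx x (Eq (Ty k) (V x) (V Y)))"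

inductive comprehension_axiom :: "fm \<Rightarrow> bool" where
  "fst Z = Ty k \<Longrightarrow> fst U = Ty (Suc k) \<Longrightarrow> \<forall>X \<in> set Xs. ty_le (fst X) (Suc k) \<Longrightarrow>
   distinct (Z # Xs) \<Longrightarrow> U \<notin> set Xs \<Longrightarrow>
   elementary (Suc k) \<phi> \<Longrightarrow> fv \<phi> \<subseteq> set (Z # Xs) \<Longrightarrow> n = gn Z Xs \<phi> \<Longrightarrow>
   comprehension_axiom
     (FEx U (sim (xapp (xc (cC n)) (map xv Xs)) (xv U) \<^bold>\<and> FAll Z (Mem k (V Z) (V U) \<^bold>\<longleftrightarrow> \<phi>)))"

text \<open>\<open>deriv cl s\<close> is derivability in the fragment with types \<open>\<le> s\<close>, with classical logic
  if \<open>cl\<close> and intuitionistic logic otherwise.\<close>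

inductive deriv :: "bool \<Rightarrow> nat \<Rightarrow> fm \<Rightarrow> bool" for cl s where
  logic: "logic_axiom \<phi> \<Longrightarrow> fm_in s \<phi> \<Longrightarrow> deriv cl s \<phi>"
| classical: "cl \<Longrightarrow> fm_in s \<phi> \<Longrightarrow> deriv cl s (\<phi> \<^bold>\<or> FNot \<phi>)"
| MP: "deriv cl s (\<phi> \<^bold>\<longrightarrow> \<psi>) \<Longrightarrow> deriv cl s \<phi> \<Longrightarrow> deriv cl s \<psi>"
| AllI: "deriv cl s (\<psi> \<^bold>\<longrightarrow> \<phi>) \<Longrightarrow> ty_le (fst x) s \<Longrightarrow> x \<notin> fv \<psi> \<Longrightarrow> deriv cl s (\<psi> \<^bold>\<longrightarrow> FAll x \<phi>)"
| ExE: "deriv cl s (\<phi> \<^bold>\<longrightarrow> \<psi>) \<Longrightarrow> ty_le (fst x) s \<Longrightarrow> x \<notin> fv \<psi> \<Longrightarrow> deriv cl s (FEx x \<phi> \<^bold>\<longrightarrow> \<psi>)"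
| equality: "equality_axiom \<phi> \<Longrightarrow> fm_in s \<phi> \<Longrightarrow> deriv cl s \<phi>"
| combinatory: "combinatory_axiom \<phi> \<Longrightarrow> fm_in s \<phi> \<Longrightarrow> deriv cl s \<phi>"
| comprehension: "comprehension_axiom \<phi> \<Longrightarrow> fm_in s \<phi> \<Longrightarrow> deriv cl s \<phi>"
| induction: "deriv cl s (subst n (Cst Zero) \<phi>) \<Longrightarrow>
    deriv cl s (\<phi> \<^bold>\<longrightarrow> FEx m (sim (xc cP \<bullet> xv n \<bullet> xc Zero) (xv m) \<^bold>\<and> subst n (V m) \<phi>)) \<Longrightarrow>
    fst n = Om \<Longrightarrow> fst m = Om \<Longrightarrow> m \<noteq> n \<Longrightarrow> m \<notin> fv \<phi> \<Longrightarrow> free_for (V m) n \<phi> \<Longrightarrow>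
    deriv cl s \<phi>"

lemma deriv_fm_in: "deriv cl s \<phi> \<Longrightarrow> fm_in s \<phi>"
  by (induction rule: deriv.induct) auto

abbreviation BT :: "nat \<Rightarrow> fm \<Rightarrow> bool" where "BT s \<equiv> deriv False s"
abbreviation BTcl :: "nat \<Rightarrow> fm \<Rightarrow> bool" where "BTcl s \<equiv> deriv True s"

section \<open>Negative translation\<close>

text \<open>The argument \<open>c\<close> of the following functions gives the translations of the comprehension
  constants.

  The translation of a comprehension constant, which has type \<open>0\<close>, may be the numerical constant \<open>0\<close>.
  An atomic formula \<open>A(0)\<close> with \<open>0\<close> in a place of type \<open>0\<close> is not well-sorted; as with external terms,
  it is read as \<open>\<exists>v (v =\<^sub>0\<^sub>\<omega> 0 \<and> A(v))\<close>.\<close>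

fun ttrans :: "(nat \<Rightarrow> const) \<Rightarrow> var \<Rightarrow> trm \<Rightarrow> trm" where
  "ttrans c v (V x) = V x"
| "ttrans c v (Cst (cC n)) = (if c n = Zero then V v else Cst (c n))"
| "ttrans c v (Cst a) = Cst a"

definition with_zero :: "var \<Rightarrow> fm \<Rightarrow> fm" where
  "with_zero v A = (if v \<in> fv A then FEx v (Eq Om (V v) (Cst Zero) \<^bold>\<and> A) else A)"

fun neg :: "(nat \<Rightarrow> const) \<Rightarrow> fm \<Rightarrow> fm" where
  "neg c (Ap a b d) =
    (let v = new (fv (Ap a b d))
     in FNot (FNot (with_zero v (Ap (ttrans c v a) (ttrans c v b) (ttrans c v d)))))"
| "neg c (Eq t a b) =
    (let v = new (fv (Eq t a b))
     in FNot (FNot (with_zero v (Eq t (ttrans c v a) (ttrans c v b)))))"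
| "neg c (Mem k a b) =
    (let v = new (fv (Mem k a b))
     in FNot (FNot (with_zero v (Mem k (ttrans c v a) (ttrans c v b)))))"
| "neg c FBot = FBot"
| "neg c (\<phi> \<^bold>\<and> \<psi>) = (neg c \<phi> \<^bold>\<and> neg c \<psi>)"
| "neg c (\<phi> \<^bold>\<or> \<psi>) = FNot (FNot (neg c \<phi> \<^bold>\<or> neg c \<psi>))"
| "neg c (\<phi> \<^bold>\<longrightarrow> \<psi>) = (neg c \<phi> \<^bold>\<longrightarrow> neg c \<psi>)"
| "neg c (FAll x \<phi>) = FAll x (neg c \<phi>)"
| "neg c (FEx x \<phi>) = FNot (FNot (FEx x (neg c \<phi>)))"

definition codes :: "nat \<Rightarrow> var \<times> var list \<times> fm \<Rightarrow> bool" where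
  "codes n = (\<lambda>(Z, Xs, \<phi>). (\<exists>k. fst Z = Ty k) \<and> (\<exists>s. fm_in s \<phi>) \<and> n = gn Z Xs \<phi>)"

text \<open>The guard \<open>m < n\<close> only serves termination: a constant \<open>c\<^sub>m\<close> occurring in \<open>\<phi>\<close> always
  has an index smaller than the Goedel number of \<open>Z.X\<^sub>1\<dots>X\<^sub>n.\<phi>\<close>. The unguarded equations are
  proved below.\<close>

function cneg :: "nat \<Rightarrow> const" where
  "cneg n =
    (if \<exists>e. codes n e
     then case (THE e. codes n e) of (Z, Xs, \<phi>) \<Rightarrow>
       cC (gn Z Xs (neg (\<lambda>m. if m < n then cneg m else Zero) \<phi>))
     else Zero)"
  by auto
termination by (relation "measure id") auto

declare cneg.simps [simp del]

definition neg_trans :: "fm \<Rightarrow> fm" where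
  "neg_trans = neg cneg"

fun tconsts :: "trm \<Rightarrow> nat set" where
  "tconsts (Cst (cC n)) = {n}"
| "tconsts _ = {}"

fun fconsts :: "fm \<Rightarrow> nat set" where
  "fconsts (Ap a b c) = tconsts a \<union> tconsts b \<union> tconsts c"
| "fconsts (Eq t a b) = tconsts a \<union> tconsts b"
| "fconsts (Mem k a b) = tconsts a \<union> tconsts b"
| "fconsts FBot = {}"
| "fconsts (\<phi> \<^bold>\<and> \<psi>) = fconsts \<phi> \<union> fconsts \<psi>"
| "fconsts (\<phi> \<^bold>\<or> \<psi>) = fconsts \<phi> \<union> fconsts \<psi>"
| "fconsts (\<phi> \<^bold>\<longrightarrow> \<psi>) = fconsts \<phi> \<union> fconsts \<psi>"
| "fconsts (FAll x \<phi>) = fconsts \<phi>"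
| "fconsts (FEx x \<phi>) = fconsts \<phi>"

lemma ttrans_cong: "(\<And>m. m \<in> tconsts a \<Longrightarrow> c m = d m) \<Longrightarrow> ttrans c v a = ttrans d v a"
  by (cases "(c, v, a)" rule: ttrans.cases) auto

lemma neg_cong: "(\<And>m. m \<in> fconsts \<phi> \<Longrightarrow> c m = d m) \<Longrightarrow> neg c \<phi> = neg d \<phi>"
proof (induction \<phi>)
  case (Ap x y z)
  have "\<And>v. ttrans c v x = ttrans d v x" "\<And>v. ttrans c v y = ttrans d v y"
    "\<And>v. ttrans c v z = ttrans d v z"
    using Ap by (auto intro!: ttrans_cong)
  thus ?case by simp
next
  case (Eq t x y)
  have "\<And>v. ttrans c v x = ttrans d v x" "\<And>v. ttrans c v y = ttrans d v y"
    using Eq by (auto intro!: ttrans_cong)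
  thus ?case by simp
next
  case (Mem k x y)
  have "\<And>v. ttrans c v x = ttrans d v x" "\<And>v. ttrans c v y = ttrans d v y"
    using Mem by (auto intro!: ttrans_cong)
  thus ?case by simp
qed auto

lemma tconsts_less: "m \<in> tconsts a \<Longrightarrow> m < trm_code a"
  by (cases a rule: tconsts.cases) auto

lemma fconsts_less: "m \<in> fconsts \<phi> \<Longrightarrow> m < fm_code \<phi>"
  by (induction \<phi>)
    (auto dest!: tconsts_less
      intro: less_le_trans le_prod_encode_1 le_prod_encode_2 order.trans)

lemma fconsts_less_gn: "m \<in> fconsts \<phi> \<Longrightarrow> m < gn Z Xs \<phi>"
  unfolding gn_def
  by (meson fconsts_less less_le_trans le_prod_encode_2)

lemma cneg_gn:
  assumes "fst Z = Ty k" "fm_in s \<phi>"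
  shows "cneg (gn Z Xs \<phi>) = cC (gn Z Xs (neg_trans \<phi>))"
proof -
  have c: "codes (gn Z Xs \<phi>) e \<longleftrightarrow> e = (Z, Xs, \<phi>)" for e
    using assms by (cases e) (auto simp: codes_def gn_inj)
  have "neg (\<lambda>m. if m < gn Z Xs \<phi> then cneg m else Zero) \<phi> = neg cneg \<phi>"
    by (rule neg_cong) (simp add: fconsts_less_gn)
  moreover have "(THE e. codes (gn Z Xs \<phi>) e) = (Z, Xs, \<phi>)"
    by (rule the_equality) (simp_all add: c)
  moreover have "\<exists>e. codes (gn Z Xs \<phi>) e" using c by simp
  ultimately show ?thesis by (subst cneg.simps) (simp add: neg_trans_def)
qed

lemma cneg_other:
  assumes "\<And>Z k Xs s \<phi>. fst Z = Ty k \<Longrightarrow> fm_in s \<phi> \<Longrightarrow> n \<noteq> gn Z Xs \<phi>"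
  shows "cneg n = Zero"
proof -
  have "\<nexists>e. codes n e" using assms by (fastforce simp: codes_def)
  thus ?thesis by (subst cneg.simps) simp
qed

end

theory Submission
  imports Defs
begin

text \<open>
  Induction on the classical derivation, using that \<open>\<phi>\<^sup>-\<close> is always stable under double negation.
  For formulas without \<open>\<forall>\<close> and \<open>\<supset>\<close>, \<open>\<phi>\<^sup>-\<close> is equivalent to \<open>\<not>\<not>\<phi>\<close> up to renaming the comprehension
  constants, which settles the nonlogical axioms; the renamed comprehension constant makes the
  translated comprehension axiom a consequence of another one.

  The translation does not literally commute with substitution, because the quantifiers that read
  \<open>0\<close> in a type-0 place have bound variables depending on the formula. Instead of substituting \<open>t\<close>
  for \<open>x\<close> inside \<open>\<phi>\<^sup>-\<close>, one proves \<open>\<phi>\<^sup>- \<equiv> (\<phi>[x/t])\<^sup>-\<close> from the assumption that \<open>x\<close> and \<open>t\<close> have a common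
  name \<open>w\<close> of type \<open>0\<close>, and only then discharges the assumption by instantiating \<open>x\<close>. In the induction
  rule, the two numbers \<open>m\<close> with \<open>pn0 \<simeq> m\<close>, one from the axiom and one under a double negation, are
  identified because application is single-valued.
\<close>

section \<open>Natural deduction\<close>

text \<open>The awkward case is a comprehension constant whose index codes nothing: it has type 0,
  but its translation is the number 0, so a translated atom may have to quantify over a type-0 name
  of 0. Such a quantifier stays in every fragment, adds no free variable and never spoils
  (k+1)-elementarity. Names are also the uniform tool for replacing terms: objects of a type k >= 1
  are compared only through the type-0 objects that name them, and an axiom gives each of them a
  name. The induction rule asks for a plain existential, whereas its translated premise yields only
  a doubly negated one. The axiom on \<open>pn0\<close> supplies a plain witness, and stability of
  the induction formula opens the double negation; this is why two witnesses appear.\<close>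

fun Conj :: "fm list \<Rightarrow> fm" where
  "Conj [] = (FBot \<^bold>\<longrightarrow> FBot)"
| "Conj (\<gamma> # \<Gamma>) = (\<gamma> \<^bold>\<and> Conj \<Gamma>)"

lemma fm_in_Conj [simp]: "fm_in s (Conj \<Gamma>) \<longleftrightarrow> (\<forall>\<gamma>\<in>set \<Gamma>. fm_in s \<gamma>)"
  by (induction \<Gamma>) auto

lemma fv_Conj [simp]: "fv (Conj \<Gamma>) = (\<Union>\<gamma>\<in>set \<Gamma>. fv \<gamma>)"
  by (induction \<Gamma>) auto

text \<open>Ill-sorted contexts entail everything; this makes weakening unconditional.\<close>

definition ent :: "nat \<Rightarrow> fm list \<Rightarrow> fm \<Rightarrow> bool" where
  "ent s \<Gamma> \<phi> \<longleftrightarrow> fm_in s (Conj \<Gamma>) \<longrightarrow> BT s (Conj \<Gamma> \<^bold>\<longrightarrow> \<phi>)"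

lemma BT_K: "BT s \<phi> \<Longrightarrow> fm_in s \<psi> \<Longrightarrow> BT s (\<psi> \<^bold>\<longrightarrow> \<phi>)"
  by (rule MP[OF logic[OF logic_axiom.K]]) (auto dest: deriv_fm_in)

lemma BT_S:
  assumes "BT s (\<chi> \<^bold>\<longrightarrow> \<phi> \<^bold>\<longrightarrow> \<psi>)" "BT s (\<chi> \<^bold>\<longrightarrow> \<phi>)"
  shows "BT s (\<chi> \<^bold>\<longrightarrow> \<psi>)"
proof -
  have "BT s ((\<chi> \<^bold>\<longrightarrow> \<phi> \<^bold>\<longrightarrow> \<psi>) \<^bold>\<longrightarrow> (\<chi> \<^bold>\<longrightarrow> \<phi>) \<^bold>\<longrightarrow> \<chi> \<^bold>\<longrightarrow> \<psi>)"
    using deriv_fm_in[OF assms(1)] by (auto intro: logic logic_axiom.S)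
  thus ?thesis using assms MP by blast
qed

lemma BT_trans: "BT s (\<phi> \<^bold>\<longrightarrow> \<psi>) \<Longrightarrow> BT s (\<psi> \<^bold>\<longrightarrow> \<chi>) \<Longrightarrow> BT s (\<phi> \<^bold>\<longrightarrow> \<chi>)"
  by (rule BT_S[OF BT_K]) (auto dest: deriv_fm_in)

lemma BT_refl: "fm_in s \<phi> \<Longrightarrow> BT s (\<phi> \<^bold>\<longrightarrow> \<phi>)"
  by (rule BT_S[OF logic[OF logic_axiom.K[of \<phi> "\<phi> \<^bold>\<longrightarrow> \<phi>"]] logic[OF logic_axiom.K]]) auto

lemma BT_andI: "BT s (\<chi> \<^bold>\<longrightarrow> \<phi>) \<Longrightarrow> BT s (\<chi> \<^bold>\<longrightarrow> \<psi>) \<Longrightarrow> BT s (\<chi> \<^bold>\<longrightarrow> \<phi> \<^bold>\<and> \<psi>)"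
  by (rule BT_S[OF BT_S[OF BT_K[OF logic[OF logic_axiom.AndI]]]]) (auto dest: deriv_fm_in)

text \<open>The deduction theorem for \<open>ent\<close>: a context keeps its newest hypothesis at
  the head of \<open>Conj\<close>, hence the order of the two antecedents.\<close>

lemma BT_curry:
  assumes "BT s (\<phi> \<^bold>\<and> \<chi> \<^bold>\<longrightarrow> \<psi>)"
  shows "BT s (\<chi> \<^bold>\<longrightarrow> \<phi> \<^bold>\<longrightarrow> \<psi>)"
proof -
  have wf: "fm_in s \<phi>" "fm_in s \<chi>" "fm_in s \<psi>" using deriv_fm_in[OF assms] by auto
  have "BT s (\<chi> \<^bold>\<longrightarrow> \<phi> \<^bold>\<longrightarrow> \<phi> \<^bold>\<and> \<chi>)"
  proof (rule BT_S)
    show "BT s (\<chi> \<^bold>\<longrightarrow> (\<phi> \<^bold>\<longrightarrow> \<chi>) \<^bold>\<longrightarrow> (\<phi> \<^bold>\<longrightarrow> \<phi> \<^bold>\<and> \<chi>))"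
      by (rule BT_K[OF MP[OF logic[OF logic_axiom.S] logic[OF logic_axiom.AndI]]]) (auto simp: wf)
    show "BT s (\<chi> \<^bold>\<longrightarrow> \<phi> \<^bold>\<longrightarrow> \<chi>)" by (rule logic[OF logic_axiom.K]) (simp add: wf)
  qed
  moreover have "BT s (\<chi> \<^bold>\<longrightarrow> (\<phi> \<^bold>\<longrightarrow> \<phi> \<^bold>\<and> \<chi>) \<^bold>\<longrightarrow> \<phi> \<^bold>\<longrightarrow> \<psi>)"
    by (rule BT_K[OF MP[OF logic[OF logic_axiom.S] BT_K[OF assms]]]) (auto simp: wf)
  ultimately show ?thesis by (rule BT_S[rotated])
qed

lemma ent_Nil [simp]: "ent s [] \<phi> \<longleftrightarrow> BT s \<phi>"
proof
  have "BT s (FBot \<^bold>\<longrightarrow> FBot)" by (rule BT_refl) simp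
  thus "ent s [] \<phi> \<Longrightarrow> BT s \<phi>" unfolding ent_def using MP by fastforce
  show "BT s \<phi> \<Longrightarrow> ent s [] \<phi>" unfolding ent_def by (simp add: BT_K)
qed

lemma BT_Conj: "fm_in s (Conj \<Gamma>) \<Longrightarrow> \<gamma> \<in> set \<Gamma> \<Longrightarrow> BT s (Conj \<Gamma> \<^bold>\<longrightarrow> \<gamma>)"
proof (induction \<Gamma>)
  case (Cons \<delta> \<Gamma>)
  have "BT s (\<delta> \<^bold>\<and> Conj \<Gamma> \<^bold>\<longrightarrow> \<delta>)" "BT s (\<delta> \<^bold>\<and> Conj \<Gamma> \<^bold>\<longrightarrow> Conj \<Gamma>)"
    using Cons.prems by (auto intro: logic logic_axiom.AndE1 logic_axiom.AndE2)
  thus ?case using Cons BT_trans by auto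
qed simp

lemma ent_hyp: "\<gamma> \<in> set \<Gamma> \<Longrightarrow> ent s \<Gamma> \<gamma>"
  unfolding ent_def using BT_Conj by blast

lemma ent_thm: "BT s \<phi> \<Longrightarrow> ent s \<Gamma> \<phi>"
  unfolding ent_def using BT_K by blast

lemma ent_mp: "ent s \<Gamma> (\<phi> \<^bold>\<longrightarrow> \<psi>) \<Longrightarrow> ent s \<Gamma> \<phi> \<Longrightarrow> ent s \<Gamma> \<psi>"
  unfolding ent_def using BT_S by blast

lemma ent_impI: "fm_in s \<phi> \<Longrightarrow> ent s (\<phi> # \<Gamma>) \<psi> \<Longrightarrow> ent s \<Gamma> (\<phi> \<^bold>\<longrightarrow> \<psi>)"
  unfolding ent_def using BT_curry by auto

lemma BT_Conj_mono:
  "fm_in s (Conj \<Delta>) \<Longrightarrow> set \<Gamma> \<subseteq> set \<Delta> \<Longrightarrow> BT s (Conj \<Delta> \<^bold>\<longrightarrow> Conj \<Gamma>)"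
proof (induction \<Gamma>)
  case Nil
  thus ?case by (auto intro!: BT_K BT_refl)
next
  case (Cons \<gamma> \<Gamma>)
  thus ?case using BT_Conj[OF Cons.prems(1), of \<gamma>] by (auto intro!: BT_andI)
qed

lemma ent_weaken: "ent s \<Gamma> \<phi> \<Longrightarrow> set \<Gamma> \<subseteq> set \<Delta> \<Longrightarrow> ent s \<Delta> \<phi>"
  unfolding ent_def by (metis BT_Conj_mono BT_trans fm_in_Conj subset_iff)

lemma ent_wf: "ent s \<Gamma> \<phi> \<Longrightarrow> fm_in s (Conj \<Gamma>) \<Longrightarrow> fm_in s \<phi>"
  unfolding ent_def using deriv_fm_in by fastforce

lemma ent_cut: "ent s \<Gamma> \<phi> \<Longrightarrow> ent s (\<phi> # \<Gamma>) \<psi> \<Longrightarrow> ent s \<Gamma> \<psi>"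
proof (cases "fm_in s (Conj \<Gamma>)")
  case True
  assume \<phi>: "ent s \<Gamma> \<phi>" and \<psi>: "ent s (\<phi> # \<Gamma>) \<psi>"
  from ent_wf[OF \<phi> True] \<psi> have "ent s \<Gamma> (\<phi> \<^bold>\<longrightarrow> \<psi>)" by (rule ent_impI)
  thus ?thesis using \<phi> by (rule ent_mp)
qed (auto simp: ent_def)

lemma ent_andI: "ent s \<Gamma> \<phi> \<Longrightarrow> ent s \<Gamma> \<psi> \<Longrightarrow> ent s \<Gamma> (\<phi> \<^bold>\<and> \<psi>)"
  unfolding ent_def using BT_andI by blast

text \<open>\<open>logic_axiom\<close> says nothing about sorts, and only \<phi> is known to be
  well-sorted from the context, so the sort of \<psi> has to be supplied.\<close>

lemma ent_axiom:
  assumes "logic_axiom (\<phi> \<^bold>\<longrightarrow> \<psi>)" "ent s \<Gamma> \<phi>" "fm_in s \<phi> \<Longrightarrow> fm_in s \<psi>"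
  shows "ent s \<Gamma> \<psi>"
proof (cases "fm_in s (Conj \<Gamma>)")
  case True
  hence "fm_in s (\<phi> \<^bold>\<longrightarrow> \<psi>)" using assms ent_wf by simp
  thus ?thesis using assms ent_mp ent_thm logic by blast
qed (auto simp: ent_def)

lemma ent_andE1: "ent s \<Gamma> (\<phi> \<^bold>\<and> \<psi>) \<Longrightarrow> ent s \<Gamma> \<phi>"
  by (rule ent_axiom[OF logic_axiom.AndE1]) auto

lemma ent_andE2: "ent s \<Gamma> (\<phi> \<^bold>\<and> \<psi>) \<Longrightarrow> ent s \<Gamma> \<psi>"
  by (rule ent_axiom[OF logic_axiom.AndE2]) auto

lemma ent_orI1: "ent s \<Gamma> \<phi> \<Longrightarrow> fm_in s \<psi> \<Longrightarrow> ent s \<Gamma> (\<phi> \<^bold>\<or> \<psi>)"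
  by (rule ent_axiom[OF logic_axiom.OrI1]) auto

lemma ent_orI2: "ent s \<Gamma> \<psi> \<Longrightarrow> fm_in s \<phi> \<Longrightarrow> ent s \<Gamma> (\<phi> \<^bold>\<or> \<psi>)"
  by (rule ent_axiom[OF logic_axiom.OrI2]) auto

lemma ent_orE:
  assumes "ent s \<Gamma> (\<phi> \<^bold>\<or> \<psi>)" "ent s (\<phi> # \<Gamma>) \<chi>" "ent s (\<psi> # \<Gamma>) \<chi>"
  shows "ent s \<Gamma> \<chi>"
proof (cases "fm_in s (Conj \<Gamma>)")
  case True
  have wf: "fm_in s \<phi>" "fm_in s \<psi>" using ent_wf[OF assms(1) True] by auto
  have "fm_in s \<chi>" using ent_wf[OF assms(2)] True wf by simp
  hence "BT s ((\<phi> \<^bold>\<longrightarrow> \<chi>) \<^bold>\<longrightarrow> (\<psi> \<^bold>\<longrightarrow> \<chi>) \<^bold>\<longrightarrow> (\<phi> \<^bold>\<or> \<psi>) \<^bold>\<longrightarrow> \<chi>)"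
    using wf by (auto intro: logic logic_axiom.OrE)
  thus ?thesis by (meson assms ent_impI wf ent_mp ent_thm)
qed (auto simp: ent_def)

section \<open>Quantifier rules\<close>

lemma fm_in_subst [simp]: "tyof t = fst x \<Longrightarrow> fm_in s (subst x t \<phi>) = fm_in s \<phi>"
proof -
  assume t: "tyof t = fst x"
  have "tyof (tsubst x t a) = tyof a" for a using t by (cases a) auto
  thus ?thesis by (induction \<phi>) auto
qed

lemma ent_allI:
  assumes "ent s \<Gamma> \<phi>" "ty_le (fst x) s" "x \<notin> fv (Conj \<Gamma>)"
  shows "ent s \<Gamma> (FAll x \<phi>)"
  using assms unfolding ent_def by (blast intro: AllI)

lemma ent_allE:
  assumes "ent s \<Gamma> (FAll x \<phi>)" "tyof t = fst x" "free_for t x \<phi>"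
  shows "ent s \<Gamma> (subst x t \<phi>)"
  using assms by (intro ent_axiom[OF logic_axiom.AllE]) auto

lemma ent_exI:
  assumes "ent s \<Gamma> (subst x t \<phi>)" "tyof t = fst x" "free_for t x \<phi>" "ty_le (fst x) s"
  shows "ent s \<Gamma> (FEx x \<phi>)"
  using assms by (intro ent_axiom[OF logic_axiom.ExI]) auto

text \<open>The Hilbert rule \<open>ExE\<close> admits no side formulas, so the context is moved
  into the consequent as \<open>Conj \<Gamma>\<close>; the two freshness conditions keep
  \<open>x\<close> out of that consequent.\<close>

lemma ent_exE:
  assumes "ent s \<Gamma> (FEx x \<phi>)" "ent s (\<phi> # \<Gamma>) \<psi>" "x \<notin> fv (Conj \<Gamma>)" "x \<notin> fv \<psi>"
  shows "ent s \<Gamma> \<psi>"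
proof (cases "fm_in s (Conj \<Gamma>)")
  case True
  have wf: "fm_in s \<phi>" "ty_le (fst x) s" using ent_wf[OF assms(1) True] by auto
  have wf': "fm_in s \<psi>" using ent_wf[OF assms(2)] True wf by simp
  have "BT s (Conj (\<phi> # \<Gamma>) \<^bold>\<longrightarrow> \<psi>)" using assms(2) True wf by (simp add: ent_def)
  hence "ent s [Conj \<Gamma>, \<phi>] \<psi>"
    by (rule ent_mp[OF ent_thm]) (auto intro!: ent_andI intro: ent_hyp)
  hence "ent s [] (\<phi> \<^bold>\<longrightarrow> Conj \<Gamma> \<^bold>\<longrightarrow> \<psi>)"
    using True wf by (intro ent_impI) auto
  hence "BT s (FEx x \<phi> \<^bold>\<longrightarrow> Conj \<Gamma> \<^bold>\<longrightarrow> \<psi>)" using assms wf by (intro ExE) auto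
  moreover have "ent s \<Gamma> (Conj \<Gamma>)" using True BT_refl by (auto simp: ent_def)
  ultimately show ?thesis using assms(1) ent_thm ent_mp by blast
qed (auto simp: ent_def)

lemma ent_imp_iff: "fm_in s \<phi> \<Longrightarrow> ent s \<Gamma> (\<phi> \<^bold>\<longrightarrow> \<psi>) \<longleftrightarrow> ent s (\<phi> # \<Gamma>) \<psi>"
proof
  assume "ent s \<Gamma> (\<phi> \<^bold>\<longrightarrow> \<psi>)"
  hence "ent s (\<phi> # \<Gamma>) (\<phi> \<^bold>\<longrightarrow> \<psi>)" by (rule ent_weaken) auto
  thus "ent s (\<phi> # \<Gamma>) \<psi>" by (rule ent_mp) (simp add: ent_hyp)
qed (rule ent_impI)

lemma ent_and_iff: "ent s \<Gamma> (\<phi> \<^bold>\<and> \<psi>) \<longleftrightarrow> ent s \<Gamma> \<phi> \<and> ent s \<Gamma> \<psi>"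
  using ent_andI ent_andE1 ent_andE2 by blast

section \<open>Substitution\<close>

fun bv :: "fm \<Rightarrow> var set" where
  "bv (\<phi> \<^bold>\<and> \<psi>) = bv \<phi> \<union> bv \<psi>"
| "bv (\<phi> \<^bold>\<or> \<psi>) = bv \<phi> \<union> bv \<psi>"
| "bv (\<phi> \<^bold>\<longrightarrow> \<psi>) = bv \<phi> \<union> bv \<psi>"
| "bv (FAll x \<phi>) = insert x (bv \<phi>)"
| "bv (FEx x \<phi>) = insert x (bv \<phi>)"
| "bv _ = {}"

lemma finite_bv [simp]: "finite (bv \<phi>)"
  by (induction \<phi>) auto

lemma tsubst_notin [simp]: "x \<notin> tv a \<Longrightarrow> tsubst x t a = a"
  by (cases a) auto

lemma tsubst_self [simp]: "tsubst x (V x) a = a"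
  by (cases a) auto

lemma subst_notin [simp]: "x \<notin> fv \<phi> \<Longrightarrow> subst x t \<phi> = \<phi>"
  by (induction \<phi>) auto

lemma subst_self [simp]: "subst x (V x) \<phi> = \<phi>"
  by (induction \<phi>) auto

lemma free_for_notin [simp]: "x \<notin> fv \<phi> \<Longrightarrow> free_for t x \<phi>"
  by (induction \<phi>) auto

lemma free_for_self [simp]: "free_for (V x) x \<phi>"
  by (induction \<phi>) auto

lemma free_for_bv: "tv t \<inter> bv \<phi> = {} \<Longrightarrow> free_for t x \<phi>"
  by (induction \<phi>) auto

lemma bv_subst [simp]: "bv (subst x t \<phi>) = bv \<phi>"
  by (induction \<phi>) auto

lemma fv_tsubst: "tv (tsubst x t a) \<subseteq> (tv a - {x}) \<union> tv t"
  by (cases a) auto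

lemma fv_subst: "fv (subst x t \<phi>) \<subseteq> (fv \<phi> - {x}) \<union> tv t"
proof (induction \<phi>)
  case (Ap a b c)
  show ?case using fv_tsubst[of x t a] fv_tsubst[of x t b] fv_tsubst[of x t c] by auto
next
  case (Eq r a b)
  show ?case using fv_tsubst[of x t a] fv_tsubst[of x t b] by auto
next
  case (Mem k a b)
  show ?case using fv_tsubst[of x t a] fv_tsubst[of x t b] by auto
qed auto

text \<open>A fresh \<open>y\<close> makes the renaming of \<open>x\<close> reversible, which is how
  \<open>FEx x \<phi>\<close> yields the existential over \<open>y\<close>.\<close>

lemma subst_inverse:
  "y \<notin> fv \<phi> \<union> bv \<phi> \<Longrightarrow> subst y (V x) (subst x (V y) \<phi>) = \<phi> \<and> free_for (V x) y (subst x (V y) \<phi>)"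
proof -
  have "y \<notin> tv a \<Longrightarrow> tsubst y (V x) (tsubst x (V y) a) = a" for a by (cases a) auto
  moreover have "y \<notin> tv t \<Longrightarrow> x \<notin> tv (tsubst x t a)" if "x \<notin> tv t" for t a
    using fv_tsubst[of x t a] that by auto
  ultimately show "y \<notin> fv \<phi> \<union> bv \<phi> \<Longrightarrow> ?thesis"
    by (induction \<phi>) auto
qed

text \<open>One bound on the indices serves all types at once, so \<open>N\<close>,
  \<open>N + 1\<close>, ... give several distinct fresh variables of arbitrary types.\<close>

lemma fresh_bound:
  assumes "finite (F :: var set)"
  obtains N where "\<And>\<tau> i. N \<le> i \<Longrightarrow> (\<tau>, i) \<notin> F"
proof -
  obtain N where "\<forall>i \<in> snd ` F. i < N" using assms finite_nat_set_iff_bounded by blast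
  hence "(\<tau>, i) \<notin> F" if "N \<le> i" for \<tau> i using that by force
  thus ?thesis by (rule that)
qed

lemma fresh_var:
  assumes "finite (F :: var set)"
  obtains x where "fst x = \<tau>" "x \<notin> F"
  using fresh_bound[OF assms] by (metis fst_conv order_refl)

lemma BT_subst:
  assumes "BT s \<phi>" "tyof t = fst x" "free_for t x \<phi>" "ty_le (fst x) s"
  shows "BT s (subst x t \<phi>)"
proof -
  have "ent s [] (FAll x \<phi>)" using assms by (intro ent_allI) auto
  hence "ent s [] (subst x t \<phi>)" using assms by (intro ent_allE)
  thus ?thesis by simp
qed

text \<open>Existential elimination for the case that the bound variable is already free in the
  context or in the goal.\<close>

lemma ent_exE_rename:
  assumes ex: "ent s \<Gamma> (FEx x \<phi>)" and \<psi>: "ent s (subst x (V y) \<phi> # \<Gamma>) \<psi>"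
    and y: "fst y = fst x" "y \<notin> fv \<phi> \<union> bv \<phi>" "y \<notin> fv (Conj \<Gamma>)" "y \<notin> fv \<psi>"
  shows "ent s \<Gamma> \<psi>"
proof (cases "fm_in s (Conj \<Gamma>)")
  case True
  hence wf: "ty_le (fst x) s" "fm_in s \<phi>" using ent_wf[OF ex] by auto
  have "ent s [\<phi>] (FEx y (subst x (V y) \<phi>))"
    using subst_inverse[OF y(2), of x] y wf
    by (intro ent_exI[where t = "V x"]) (auto intro: ent_hyp)
  hence *: "ent s [\<phi>, FEx x \<phi>] (FEx y (subst x (V y) \<phi>))"
    by (rule ent_weaken) simp
  have "ent s [FEx x \<phi>] (FEx y (subst x (V y) \<phi>))"
    using fv_subst[of x "V y" \<phi>] y(1) by (intro ent_exE[OF ent_hyp *]) auto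
  hence "ent s (FEx x \<phi> # \<Gamma>) (FEx y (subst x (V y) \<phi>))"
    by (rule ent_weaken) auto
  hence "ent s \<Gamma> (FEx y (subst x (V y) \<phi>))" using ex ent_cut by blast
  thus ?thesis using \<psi> y(3,4) by (rule ent_exE)
qed (auto simp: ent_def)

section \<open>Equality of terms\<close>

text \<open>An empty \<open>bv\<close> excludes capture. The substitutions act one after another; at
  variables absent from all the terms this amounts to a simultaneous substitution.\<close>

lemma BT_substs:
  assumes "BT s \<phi>" "bv \<phi> = {}" "\<forall>(x, t) \<in> set ps. tyof t = fst x \<and> ty_le (fst x) s"
  shows "BT s (fold (\<lambda>(x, t). subst x t) ps \<phi>)"
  using assms
proof (induction ps arbitrary: \<phi>)
  case (Cons p ps)
  obtain x t where p: "p = (x, t)" by (cases p)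
  have "BT s (subst x t \<phi>)"
    using Cons.prems by (intro BT_subst free_for_bv) (auto simp: p)
  thus ?case using Cons by (simp add: p)
qed simp

text \<open>The sort of \<phi> may be assumed, because a context entailing an ill-sorted formula is
  itself ill-sorted and entails everything. Sort conditions on terms can thus be read off the
  hypotheses.\<close>

lemma ent_use:
  assumes "ent s \<Gamma> \<phi>" "fm_in s \<phi> \<Longrightarrow> BT s (\<phi> \<^bold>\<longrightarrow> \<psi>)"
  shows "ent s \<Gamma> \<psi>"
proof (cases "fm_in s (Conj \<Gamma>)")
  case True
  thus ?thesis using assms ent_wf ent_mp ent_thm by blast
qed (auto simp: ent_def)

lemma ent_refl:
  assumes "tyof a = Ty 0"
  shows "ent s \<Gamma> (Eq (Ty 0) a a)"
proof -
  have "BT s (Eq (Ty 0) (V (Ty 0, 0)) (V (Ty 0, 0)))" by (auto intro!: equality equality_axiom.refl)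
  from BT_substs[OF this, of "[((Ty 0, 0), a)]"] assms show ?thesis by (auto intro: ent_thm)
qed

text \<open>The axiom concerns variables, but constants are needed too: it is taken at fresh
  variables, which \<open>BT_substs\<close> then replaces. The congruences below follow the same
  pattern.\<close>

lemma ent_eq_eq:
  assumes "ent s \<Gamma> (Eq (Ty k) u a)" "ent s \<Gamma> (Eq (Ty k) v a)" "ent s \<Gamma> (Eq (Ty n) u b)"
  shows "ent s \<Gamma> (Eq (Ty n) v b)"
proof (rule ent_use)
  show "ent s \<Gamma> (Eq (Ty k) u a \<^bold>\<and> Eq (Ty k) v a \<^bold>\<and> Eq (Ty n) u b)"
    using assms by (intro ent_andI)
next
  assume wf: "fm_in s (Eq (Ty k) u a \<^bold>\<and> Eq (Ty k) v a \<^bold>\<and> Eq (Ty n) u b)"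
  obtain N where N: "\<And>\<tau> i. N \<le> i \<Longrightarrow> (\<tau>, i) \<notin> tv u \<union> tv v \<union> tv a \<union> tv b"
    by (rule fresh_bound[of "tv u \<union> tv v \<union> tv a \<union> tv b"]) auto
  let ?u = "(Ty 0, N)" and ?v = "(Ty 0, N+1)" and ?a = "(Ty k, N+2)" and ?b = "(Ty n, N+3)"
  have "BT s (Eq (Ty k) (V ?u) (V ?a) \<^bold>\<and> Eq (Ty k) (V ?v) (V ?a) \<^bold>\<and> Eq (Ty n) (V ?u) (V ?b)
      \<^bold>\<longrightarrow> Eq (Ty n) (V ?v) (V ?b))"
    using wf by (intro equality equality_axiom.eq_eq) auto
  from BT_substs[OF this, of "[(?u, u), (?v, v), (?a, a), (?b, b)]"] wf N
  show "BT s (Eq (Ty k) u a \<^bold>\<and> Eq (Ty k) v a \<^bold>\<and> Eq (Ty n) u b \<^bold>\<longrightarrow> Eq (Ty n) v b)" by auto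
qed

lemma ent_num_eq:
  assumes "ent s \<Gamma> (Eq Om u a)" "ent s \<Gamma> (Eq Om v a)"
  shows "ent s \<Gamma> (Eq (Ty 0) u v)"
proof (rule ent_use)
  show "ent s \<Gamma> (Eq Om u a \<^bold>\<and> Eq Om v a)"
    using assms by (intro ent_andI)
next
  assume wf: "fm_in s (Eq Om u a \<^bold>\<and> Eq Om v a)"
  obtain N where N: "\<And>\<tau> i. N \<le> i \<Longrightarrow> (\<tau>, i) \<notin> tv u \<union> tv v \<union> tv a"
    by (rule fresh_bound[of "tv u \<union> tv v \<union> tv a"]) auto
  let ?u = "(Ty 0, N)" and ?v = "(Ty 0, N+1)" and ?a = "(Om, N+2)"
  have "BT s (Eq Om (V ?u) (V ?a) \<^bold>\<and> Eq Om (V ?v) (V ?a) \<^bold>\<longrightarrow> Eq (Ty 0) (V ?u) (V ?v))"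
    using wf by (intro equality equality_axiom.num_eq) auto
  from BT_substs[OF this, of "[(?u, u), (?v, v), (?a, a)]"] wf N
  show "BT s (Eq Om u a \<^bold>\<and> Eq Om v a \<^bold>\<longrightarrow> Eq (Ty 0) u v)" by auto
qed

lemma ent_eq_num:
  assumes "ent s \<Gamma> (Eq Om u a)" "ent s \<Gamma> (Eq (Ty 0) u v)"
  shows "ent s \<Gamma> (Eq Om v a)"
proof (rule ent_use)
  show "ent s \<Gamma> (Eq Om u a \<^bold>\<and> Eq (Ty 0) u v)"
    using assms by (intro ent_andI)
next
  assume wf: "fm_in s (Eq Om u a \<^bold>\<and> Eq (Ty 0) u v)"
  obtain N where N: "\<And>\<tau> i. N \<le> i \<Longrightarrow> (\<tau>, i) \<notin> tv u \<union> tv v \<union> tv a"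
    by (rule fresh_bound[of "tv u \<union> tv v \<union> tv a"]) auto
  let ?u = "(Ty 0, N)" and ?v = "(Ty 0, N+1)" and ?a = "(Om, N+2)"
  have "BT s (Eq Om (V ?u) (V ?a) \<^bold>\<and> Eq (Ty 0) (V ?u) (V ?v) \<^bold>\<longrightarrow> Eq Om (V ?v) (V ?a))"
    using wf by (intro equality equality_axiom.eq_num) auto
  from BT_substs[OF this, of "[(?u, u), (?v, v), (?a, a)]"] wf N
  show "BT s (Eq Om u a \<^bold>\<and> Eq (Ty 0) u v \<^bold>\<longrightarrow> Eq Om v a)" by auto
qed

lemma ent_Ap_cong:
  assumes "ent s \<Gamma> (Ap a b c)" "ent s \<Gamma> (Eq (Ty 0) a a')" "ent s \<Gamma> (Eq (Ty 0) b b')"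
    "ent s \<Gamma> (Eq (Ty 0) c c')"
  shows "ent s \<Gamma> (Ap a' b' c')"
proof (rule ent_use)
  let ?A = "Ap a b c \<^bold>\<and> Eq (Ty 0) a a' \<^bold>\<and> Eq (Ty 0) b b' \<^bold>\<and> Eq (Ty 0) c c'"
  show "ent s \<Gamma> ?A"
    using assms by (intro ent_andI)
  assume wf: "fm_in s ?A"
  let ?F = "tv a \<union> tv b \<union> tv c \<union> tv a' \<union> tv b' \<union> tv c'"
  obtain N where N: "\<And>\<tau> i. N \<le> i \<Longrightarrow> (\<tau>, i) \<notin> ?F"
    by (rule fresh_bound[of ?F]) auto
  let ?v = "\<lambda>i. (Ty 0, N + i)"
  have "BT s (Ap (V (?v 0)) (V (?v 1)) (V (?v 2)) \<^bold>\<and> Eq (Ty 0) (V (?v 0)) (V (?v 3))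
      \<^bold>\<and> Eq (Ty 0) (V (?v 1)) (V (?v 4)) \<^bold>\<and> Eq (Ty 0) (V (?v 2)) (V (?v 5))
      \<^bold>\<longrightarrow> Ap (V (?v 3)) (V (?v 4)) (V (?v 5)))"
    by (intro equality equality_axiom.eq_Ap) auto
  from BT_substs[OF this, of "[(?v 0, a), (?v 1, b), (?v 2, c), (?v 3, a'), (?v 4, b'), (?v 5, c')]"]
    wf N
  show "BT s (?A \<^bold>\<longrightarrow> Ap a' b' c')" by auto
qed

lemma ent_Ap_fun:
  assumes "ent s \<Gamma> (Ap a b c)" "ent s \<Gamma> (Ap a b c')"
  shows "ent s \<Gamma> (Eq (Ty 0) c c')"
proof (rule ent_use)
  let ?A = "Ap a b c \<^bold>\<and> Ap a b c'"
  show "ent s \<Gamma> ?A"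
    using assms by (intro ent_andI)
  assume wf: "fm_in s ?A"
  let ?F = "tv a \<union> tv b \<union> tv c \<union> tv c'"
  obtain N where N: "\<And>\<tau> i. N \<le> i \<Longrightarrow> (\<tau>, i) \<notin> ?F"
    by (rule fresh_bound[of ?F]) auto
  let ?v = "\<lambda>i. (Ty 0, N + i)"
  have "BT s (Ap (V (?v 0)) (V (?v 1)) (V (?v 2)) \<^bold>\<and> Ap (V (?v 0)) (V (?v 1)) (V (?v 3))
      \<^bold>\<longrightarrow> Eq (Ty 0) (V (?v 2)) (V (?v 3)))"
    by (intro combinatory combinatory_axiom.Ap_fun) auto
  from BT_substs[OF this, of "[(?v 0, a), (?v 1, b), (?v 2, c), (?v 3, c')]"] wf N
  show "BT s (?A \<^bold>\<longrightarrow> Eq (Ty 0) c c')" by auto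
qed

text \<open>Supplies the names that later arguments assume and then discharge by existential
  elimination.\<close>

lemma BT_named:
  assumes "tyof a = \<tau>" "ty_le \<tau> s" "fst w = Ty 0" "w \<notin> tv a"
  shows "BT s (FEx w (Eq \<tau> (V w) a))"
proof (cases \<tau>)
  case Om
  obtain N where N: "\<And>\<tau> i. N \<le> i \<Longrightarrow> (\<tau>, i) \<notin> {w}"
    by (rule fresh_bound[of "{w}"]) auto
  have "BT s (FEx w (Eq Om (V w) (V (Om, N))))"
    using assms by (intro combinatory combinatory_axiom.num_obj) auto
  hence "BT s (subst (Om, N) a (FEx w (Eq Om (V w) (V (Om, N)))))"
    using assms N Om by (intro BT_subst) auto
  thus ?thesis using N[of N Om] Om by auto
next
  case (Ty k)
  obtain N where N: "\<And>\<tau> i. N \<le> i \<Longrightarrow> (\<tau>, i) \<notin> {w}"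
    by (rule fresh_bound[of "{w}"]) auto
  have "BT s (FEx w (Eq (Ty k) (V w) (V (Ty k, N))))"
    using assms Ty N[of N "Ty k"] by (intro combinatory combinatory_axiom.type_obj) auto
  hence "BT s (subst (Ty k, N) a (FEx w (Eq (Ty k) (V w) (V (Ty k, N)))))"
    using assms N Ty by (intro BT_subst) auto
  thus ?thesis using N[of N "Ty k"] Ty by auto
qed

lemma ent_eqv:
  assumes "ent s \<Gamma> (Eq (fst X) (V w) (V X))" "ent s \<Gamma> (Eq (fst X) (V w) (V U))"
    "fst U = fst X" "fst w = Ty 0"
  shows "ent s \<Gamma> (eqv X U)"
proof -
  have "new {X, U} \<noteq> X" "new {X, U} \<noteq> U" using new_notin[of "{X, U}"] by auto
  thus ?thesis unfolding sim_def Let_def using assms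
    by (intro ent_exI[where t = "V w"]) (auto intro: ent_andI simp: insert_commute)
qed

text \<open>The membership axiom replaces both arguments at once; reflexivity lets one of them
  stay.\<close>

lemma BT_eqv_refl:
  assumes "ty_le (fst X) s"
  shows "BT s (eqv X X)"
proof -
  obtain w where w: "fst w = Ty 0" "w \<notin> insert X (fv (eqv X X))"
    by (rule fresh_var[of "insert X (fv (eqv X X))" "Ty 0"]) auto
  have "ent s [] (eqv X X)"
  proof (rule ent_exE)
    show "ent s [] (FEx w (Eq (fst X) (V w) (V X)))"
      using BT_named[of "V X" "fst X" s w] assms w by simp
    show "ent s [Eq (fst X) (V w) (V X)] (eqv X X)"
      using w by (intro ent_eqv[of s _ X w]) (auto intro: ent_hyp)
  qed (use w in auto)
  thus ?thesis by simp
qed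

lemma ent_Mem_cong1:
  assumes "ent s \<Gamma> (Mem k a b)" "ent s \<Gamma> (Eq (Ty k) u a)" "ent s \<Gamma> (Eq (Ty k) u a')"
  shows "ent s \<Gamma> (Mem k a' b)"
proof (rule ent_use)
  let ?A = "\<lambda>u a a' b. Mem k a b \<^bold>\<and> Eq (Ty k) u a \<^bold>\<and> Eq (Ty k) u a'"
  show "ent s \<Gamma> (?A u a a' b)"
    using assms by (intro ent_andI)
  assume wf: "fm_in s (?A u a a' b)"
  let ?F = "tv a \<union> tv b \<union> tv u \<union> tv a'"
  obtain N where N: "\<And>\<tau> i. N \<le> i \<Longrightarrow> (\<tau>, i) \<notin> ?F"
    by (rule fresh_bound[of ?F]) auto
  let ?u = "(Ty 0, N)" and ?a = "(Ty k, N+1)" and ?a' = "(Ty k, N+2)" and ?b = "(Ty (Suc k), N+3)"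
  let ?H = "?A (V ?u) (V ?a) (V ?a') (V ?b)"
  have "BT s (Mem k (V ?a) (V ?b) \<^bold>\<and> eqv ?a ?a' \<^bold>\<and> eqv ?b ?b \<^bold>\<longrightarrow> Mem k (V ?a') (V ?b))"
    using wf by (intro equality equality_axiom.eq_Mem) (auto simp: sim_def Let_def)
  moreover have "ent s [?H] ?H" by (simp add: ent_hyp)
  hence "ent s [?H] (Mem k (V ?a) (V ?b) \<^bold>\<and> eqv ?a ?a' \<^bold>\<and> eqv ?b ?b)"
    using wf unfolding ent_and_iff
    by (auto intro: ent_eqv[where w = "?u"] intro!: ent_thm[OF BT_eqv_refl])
  ultimately have "ent s [?H] (Mem k (V ?a') (V ?b))" using ent_thm ent_mp by blast
  hence "ent s [] (?H \<^bold>\<longrightarrow> Mem k (V ?a') (V ?b))" using wf by (intro ent_impI) auto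
  hence "BT s (?H \<^bold>\<longrightarrow> Mem k (V ?a') (V ?b))" by simp
  from BT_substs[OF this, of "[(?u, u), (?a, a), (?a', a'), (?b, b)]"] wf N
  show "BT s (?A u a a' b \<^bold>\<longrightarrow> Mem k a' b)" by auto
qed

lemma ent_Mem_cong2:
  assumes "ent s \<Gamma> (Mem k a b)" "ent s \<Gamma> (Eq (Ty (Suc k)) u b)" "ent s \<Gamma> (Eq (Ty (Suc k)) u b')"
  shows "ent s \<Gamma> (Mem k a b')"
proof (rule ent_use)
  let ?A = "\<lambda>u a b b'. Mem k a b \<^bold>\<and> Eq (Ty (Suc k)) u b \<^bold>\<and> Eq (Ty (Suc k)) u b'"
  show "ent s \<Gamma> (?A u a b b')"
    using assms by (intro ent_andI)
  assume wf: "fm_in s (?A u a b b')"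
  let ?F = "tv a \<union> tv b \<union> tv u \<union> tv b'"
  obtain N where N: "\<And>\<tau> i. N \<le> i \<Longrightarrow> (\<tau>, i) \<notin> ?F"
    by (rule fresh_bound[of ?F]) auto
  let ?u = "(Ty 0, N)" and ?a = "(Ty k, N+1)" and ?b = "(Ty (Suc k), N+2)" and ?b' = "(Ty (Suc k), N+3)"
  let ?H = "?A (V ?u) (V ?a) (V ?b) (V ?b')"
  have "BT s (Mem k (V ?a) (V ?b) \<^bold>\<and> eqv ?a ?a \<^bold>\<and> eqv ?b ?b' \<^bold>\<longrightarrow> Mem k (V ?a) (V ?b'))"
    using wf by (intro equality equality_axiom.eq_Mem) (auto simp: sim_def Let_def)
  moreover have "ent s [?H] ?H" by (simp add: ent_hyp)
  hence "ent s [?H] (Mem k (V ?a) (V ?b) \<^bold>\<and> eqv ?a ?a \<^bold>\<and> eqv ?b ?b')"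
    using wf unfolding ent_and_iff
    by (auto intro: ent_eqv[where w = "?u"] intro!: ent_thm[OF BT_eqv_refl])
  ultimately have "ent s [?H] (Mem k (V ?a) (V ?b'))" using ent_thm ent_mp by blast
  hence "ent s [] (?H \<^bold>\<longrightarrow> Mem k (V ?a) (V ?b'))" using wf by (intro ent_impI) auto
  hence "BT s (?H \<^bold>\<longrightarrow> Mem k (V ?a) (V ?b'))" by simp
  from BT_substs[OF this, of "[(?u, u), (?a, a), (?b, b), (?b', b')]"] wf N
  show "BT s (?A u a b b' \<^bold>\<longrightarrow> Mem k a b')" by auto
qed

text \<open>The types \<open>k \<ge> 1\<close> have no equality of their own: \<open>a\<close> and \<open>b\<close> are provably equal if they have
  a common name \<open>u\<close> of type \<open>0\<close>.\<close>

definition co_named :: "nat \<Rightarrow> fm list \<Rightarrow> trm \<Rightarrow> trm \<Rightarrow> bool" where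
  "co_named s \<Gamma> a b \<longleftrightarrow> a = b \<or>
    (\<exists>u. tyof b = tyof a \<and> ent s \<Gamma> (Eq (tyof a) u a) \<and> ent s \<Gamma> (Eq (tyof a) u b))"

lemma co_named_sym: "co_named s \<Gamma> a b \<Longrightarrow> co_named s \<Gamma> b a"
  unfolding co_named_def by metis

lemma co_named_type: "co_named s \<Gamma> a b \<Longrightarrow> tyof b = tyof a"
  unfolding co_named_def by metis

text \<open>At type 0 an object names itself, so \<open>eq_eq\<close> with \<open>a\<close> as the
  second name of \<open>a\<close> eliminates the common name.\<close>

lemma co_named_eq: "co_named s \<Gamma> a b \<Longrightarrow> tyof a = Ty 0 \<Longrightarrow> ent s \<Gamma> (Eq (Ty 0) a b)"
  unfolding co_named_def by (metis ent_eq_eq ent_refl)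

section \<open>Replacement of terms in atoms\<close>

fun atomic :: "fm \<Rightarrow> bool" where
  "atomic (Ap a b c) = True"
| "atomic (Eq t a b) = True"
| "atomic (Mem k a b) = True"
| "atomic _ = False"

text \<open>Capture is not checked: beyond atoms, the map is only used where it introduces no
  variable.\<close>

fun map_fm :: "(trm \<Rightarrow> trm) \<Rightarrow> fm \<Rightarrow> fm" where
  "map_fm f (Ap a b c) = Ap (f a) (f b) (f c)"
| "map_fm f (Eq t a b) = Eq t (f a) (f b)"
| "map_fm f (Mem k a b) = Mem k (f a) (f b)"
| "map_fm f FBot = FBot"
| "map_fm f (\<phi> \<^bold>\<and> \<psi>) = (map_fm f \<phi> \<^bold>\<and> map_fm f \<psi>)"
| "map_fm f (\<phi> \<^bold>\<or> \<psi>) = (map_fm f \<phi> \<^bold>\<or> map_fm f \<psi>)"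
| "map_fm f (\<phi> \<^bold>\<longrightarrow> \<psi>) = (map_fm f \<phi> \<^bold>\<longrightarrow> map_fm f \<psi>)"
| "map_fm f (FAll x \<phi>) = FAll x (map_fm f \<phi>)"
| "map_fm f (FEx x \<phi>) = FEx x (map_fm f \<phi>)"

text \<open>Leibniz's law for atoms. The right argument of an equality and the arguments of a
  membership may have higher type, where the replacement has to go through the common name
  itself.\<close>

lemma ent_map_fm:
  assumes "atomic A" "ent s \<Gamma> (map_fm f A)" "fm_in s (map_fm f A)" "\<And>a. co_named s \<Gamma> (f a) (g a)"
  shows "ent s \<Gamma> (map_fm g A)"
proof (cases A)
  case (Ap a b c)
  thus ?thesis using assms(2,3) co_named_eq[OF assms(4)] ent_Ap_cong by simp
next
  case (Eq \<tau> a b)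
  have "ent s \<Gamma> (Eq \<tau> (g a) (f b))"
  proof (cases \<tau>)
    case Om
    thus ?thesis using assms(2,3) co_named_eq[OF assms(4), of a] ent_eq_num by (auto simp: Eq)
  next
    case (Ty n)
    have "tyof (g a) = Ty 0" using co_named_type[OF assms(4), of a] assms(3) Eq by simp
    thus ?thesis using assms(2,3) co_named_eq[OF assms(4), of a] Ty
      by (auto simp: Eq intro: ent_eq_eq[where k = 0 and u = "f a" and a = "g a"] ent_refl)
  qed
  \<comment> \<open>Both \<open>u\<close> and \<open>g a\<close> name \<open>f b\<close>, hence
    \<open>g a\<close> names everything that \<open>u\<close> names.\<close>
  moreover have "ent s \<Gamma> (Eq \<tau> (g a) (g b))"
    if "ent s \<Gamma> (Eq \<tau> u (f b))" "ent s \<Gamma> (Eq \<tau> u (g b))" for u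
  proof (cases \<tau>)
    case Om
    thus ?thesis using that calculation ent_num_eq ent_eq_num by blast
  next
    case (Ty n)
    thus ?thesis using that calculation ent_eq_eq by blast
  qed
  ultimately show ?thesis using assms(3) assms(4)[of b] unfolding Eq co_named_def by auto
next
  case (Mem k a b)
  hence M: "ent s \<Gamma> (Mem k (f a) (f b))" and ty: "tyof (f a) = Ty k" "tyof (f b) = Ty (Suc k)"
    using assms by auto
  from assms(4)[of a] M ty have "ent s \<Gamma> (Mem k (g a) (f b))"
    unfolding co_named_def using ent_Mem_cong1 by metis
  with assms(4)[of b] ty show ?thesis
    unfolding co_named_def Mem map_fm.simps using ent_Mem_cong2 by metis
qed (use assms in auto)

section \<open>Equivalence and double negation\<close>

lemma ent_weaken1: "ent s \<Gamma> \<phi> \<Longrightarrow> ent s (\<psi> # \<Gamma>) \<phi>"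
  by (erule ent_weaken) auto

text \<open>Contexts ordered by inclusion behave like the worlds of a Kripke model. This turns
  provable equivalences into equivalences of the metalogic.\<close>

lemma ent_imp_kripke:
  assumes "fm_in s \<phi>"
  shows "ent s \<Gamma> (\<phi> \<^bold>\<longrightarrow> \<psi>) \<longleftrightarrow> (\<forall>\<Delta>. set \<Gamma> \<subseteq> set \<Delta> \<longrightarrow> ent s \<Delta> \<phi> \<longrightarrow> ent s \<Delta> \<psi>)"
    (is "_ \<longleftrightarrow> ?K")
proof
  show "ent s \<Gamma> (\<phi> \<^bold>\<longrightarrow> \<psi>) \<Longrightarrow> ?K" using ent_weaken ent_mp by blast
  assume ?K
  moreover have "set \<Gamma> \<subseteq> set (\<phi> # \<Gamma>)" "ent s (\<phi> # \<Gamma>) \<phi>" by (auto intro: ent_hyp)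
  ultimately have "ent s (\<phi> # \<Gamma>) \<psi>" by blast
  thus "ent s \<Gamma> (\<phi> \<^bold>\<longrightarrow> \<psi>)" using assms ent_impI by blast
qed

lemma ent_iffI:
  assumes "fm_in s \<phi>" "fm_in s \<psi>" "\<And>\<Delta>. set \<Gamma> \<subseteq> set \<Delta> \<Longrightarrow> ent s \<Delta> \<phi> \<longleftrightarrow> ent s \<Delta> \<psi>"
  shows "ent s \<Gamma> (\<phi> \<^bold>\<longleftrightarrow> \<psi>)"
  using assms by (simp add: ent_and_iff ent_imp_kripke)

lemma ent_iffD:
  "ent s \<Gamma> (\<phi> \<^bold>\<longleftrightarrow> \<psi>) \<Longrightarrow> set \<Gamma> \<subseteq> set \<Delta> \<Longrightarrow> ent s \<Delta> \<phi> \<longleftrightarrow> ent s \<Delta> \<psi>"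
  using ent_weaken ent_mp unfolding ent_and_iff by blast

lemma ent_iff_trans:
  assumes "fm_in s \<phi>" "fm_in s \<chi>" "ent s \<Gamma> (\<phi> \<^bold>\<longleftrightarrow> \<psi>)" "ent s \<Gamma> (\<psi> \<^bold>\<longleftrightarrow> \<chi>)"
  shows "ent s \<Gamma> (\<phi> \<^bold>\<longleftrightarrow> \<chi>)"
  using assms(1,2) ent_iffD[OF assms(3)] ent_iffD[OF assms(4)] by (auto intro!: ent_iffI)

lemma ent_iff_sym: "ent s \<Gamma> (\<phi> \<^bold>\<longleftrightarrow> \<psi>) \<Longrightarrow> ent s \<Gamma> (\<psi> \<^bold>\<longleftrightarrow> \<phi>)"
  by (simp add: ent_and_iff)

lemma ent_iff_refl: "fm_in s \<phi> \<Longrightarrow> ent s \<Gamma> (\<phi> \<^bold>\<longleftrightarrow> \<phi>)"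
  by (auto intro: ent_iffI)

context
  fixes s \<Gamma> \<phi> \<phi>' \<psi> \<psi>'
  assumes wf: "fm_in s \<phi>" "fm_in s \<phi>'" "fm_in s \<psi>" "fm_in s \<psi>'"
    and iff: "ent s \<Gamma> (\<phi> \<^bold>\<longleftrightarrow> \<phi>')" "ent s \<Gamma> (\<psi> \<^bold>\<longleftrightarrow> \<psi>')"
begin

lemma ent_and_cong: "ent s \<Gamma> ((\<phi> \<^bold>\<and> \<psi>) \<^bold>\<longleftrightarrow> (\<phi>' \<^bold>\<and> \<psi>'))"
  using wf ent_iffD[OF iff(1)] ent_iffD[OF iff(2)] by (intro ent_iffI) (auto simp: ent_and_iff)

lemma ent_imp_cong: "ent s \<Gamma> ((\<phi> \<^bold>\<longrightarrow> \<psi>) \<^bold>\<longleftrightarrow> (\<phi>' \<^bold>\<longrightarrow> \<psi>'))"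
  using wf ent_iffD[OF iff(1)] ent_iffD[OF iff(2)]
  by (intro ent_iffI) (auto simp: ent_imp_kripke dest: subset_trans)

text \<open>A context may entail a disjunction without entailing either part, so the reading by
  extensions does not decompose it; each direction is a case distinction.\<close>

lemma ent_or_cong: "ent s \<Gamma> ((\<phi> \<^bold>\<or> \<psi>) \<^bold>\<longleftrightarrow> (\<phi>' \<^bold>\<or> \<psi>'))"
proof -
  have "ent s \<Delta> (\<alpha> \<^bold>\<or> \<beta>) \<Longrightarrow> ent s \<Delta> (\<alpha>' \<^bold>\<or> \<beta>')"
    if "ent s \<Gamma> (\<alpha> \<^bold>\<longleftrightarrow> \<alpha>')" "ent s \<Gamma> (\<beta> \<^bold>\<longleftrightarrow> \<beta>')" "fm_in s \<alpha>'" "fm_in s \<beta>'" "set \<Gamma> \<subseteq> set \<Delta>"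
    for \<alpha> \<alpha>' \<beta> \<beta>' \<Delta>
  proof (erule ent_orE)
    have "ent s (\<alpha> # \<Delta>) \<alpha>'" "ent s (\<beta> # \<Delta>) \<beta>'"
      using ent_iffD[OF that(1), of "\<alpha> # \<Delta>"] ent_iffD[OF that(2), of "\<beta> # \<Delta>"] that(5)
      by (auto simp: ent_hyp)
    thus "ent s (\<alpha> # \<Delta>) (\<alpha>' \<^bold>\<or> \<beta>')" "ent s (\<beta> # \<Delta>) (\<alpha>' \<^bold>\<or> \<beta>')"
      using that by (auto intro: ent_orI1 ent_orI2)
  qed
  from this[OF iff wf(2,4)] this[OF ent_iff_sym[OF iff(1)] ent_iff_sym[OF iff(2)] wf(1,3)]
  show ?thesis using wf by (intro ent_iffI) auto
qed

end

context
  fixes s \<Gamma> \<phi> \<phi>' x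
  assumes wf: "fm_in s \<phi>" "fm_in s \<phi>'" and iff: "ent s \<Gamma> (\<phi> \<^bold>\<longleftrightarrow> \<phi>')"
    and x: "x \<notin> fv (Conj \<Gamma>)" "ty_le (fst x) s"
begin

lemma ent_all_cong: "ent s \<Gamma> (FAll x \<phi> \<^bold>\<longleftrightarrow> FAll x \<phi>')"
proof -
  have "ent s (FAll x \<alpha> # \<Gamma>) (FAll x \<beta>)" if "ent s \<Gamma> (\<alpha> \<^bold>\<longleftrightarrow> \<beta>)" for \<alpha> \<beta>
  proof (rule ent_allI)
    have "ent s (FAll x \<alpha> # \<Gamma>) (subst x (V x) \<alpha>)"
      by (rule ent_allE) (auto intro: ent_hyp)
    thus "ent s (FAll x \<alpha> # \<Gamma>) \<beta>" using ent_iffD[OF that, of "FAll x \<alpha> # \<Gamma>"] by auto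
  qed (use x in auto)
  from this[OF iff] this[OF ent_iff_sym[OF iff]]
  show ?thesis using wf x by (intro ent_andI ent_impI) auto
qed

lemma ent_ex_cong: "ent s \<Gamma> (FEx x \<phi> \<^bold>\<longleftrightarrow> FEx x \<phi>')"
proof -
  have "ent s (FEx x \<alpha> # \<Gamma>) (FEx x \<beta>)" if "ent s \<Gamma> (\<alpha> \<^bold>\<longleftrightarrow> \<beta>)" for \<alpha> \<beta>
  proof (rule ent_exE)
    show "ent s (FEx x \<alpha> # \<Gamma>) (FEx x \<alpha>)" by (auto intro: ent_hyp)
    have "ent s (\<alpha> # FEx x \<alpha> # \<Gamma>) \<beta>"
      using ent_iffD[OF that, of "\<alpha> # FEx x \<alpha> # \<Gamma>"] by (auto simp: ent_hyp)
    thus "ent s (\<alpha> # FEx x \<alpha> # \<Gamma>) (FEx x \<beta>)"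
      using x(2) by (intro ent_exI[where t = "V x"]) auto
  qed (use x in auto)
  from this[OF iff] this[OF ent_iff_sym[OF iff]]
  show ?thesis using wf x by (intro ent_andI ent_impI) auto
qed

end

lemma ent_nn_cong:
  assumes "fm_in s \<phi>" "fm_in s \<phi>'" "ent s \<Gamma> (\<phi> \<^bold>\<longleftrightarrow> \<phi>')"
  shows "ent s \<Gamma> (FNot (FNot \<phi>) \<^bold>\<longleftrightarrow> FNot (FNot \<phi>'))"
  using assms by (intro ent_imp_cong ent_iff_refl) auto

lemma ent_nnI: "ent s \<Gamma> \<phi> \<Longrightarrow> fm_in s \<phi> \<Longrightarrow> ent s \<Gamma> (FNot (FNot \<phi>))"
  by (auto simp: ent_imp_kripke dest: ent_weaken)

section \<open>Stability under double negation\<close>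

definition stable :: "nat \<Rightarrow> fm \<Rightarrow> bool" where
  "stable s \<phi> \<longleftrightarrow> fm_in s \<phi> \<and> BT s (FNot (FNot \<phi>) \<^bold>\<longrightarrow> \<phi>)"

lemma stableI: "fm_in s \<phi> \<Longrightarrow> ent s [FNot (FNot \<phi>)] \<phi> \<Longrightarrow> stable s \<phi>"
  unfolding stable_def using ent_impI[of s "FNot (FNot \<phi>)" "[]"] by auto

lemma stableD: "stable s \<phi> \<Longrightarrow> ent s \<Gamma> (FNot (FNot \<phi>)) \<Longrightarrow> ent s \<Gamma> \<phi>"
  unfolding stable_def using ent_thm ent_mp by blast

lemma ent_nn_mono:
  assumes "ent s \<Gamma> (FNot (FNot \<phi>))" "ent s (\<phi> # \<Gamma>) \<psi>" "fm_in s \<phi>" "fm_in s \<psi>"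
  shows "ent s \<Gamma> (FNot (FNot \<psi>))"
proof (rule ent_impI)
  have "ent s (\<phi> # FNot \<psi> # \<Gamma>) (FNot \<psi>)" "ent s (\<phi> # FNot \<psi> # \<Gamma>) \<psi>"
    using ent_weaken[OF assms(2), of "\<phi> # FNot \<psi> # \<Gamma>"] by (auto simp: ent_hyp)
  hence "ent s (FNot \<psi> # \<Gamma>) (FNot \<phi>)" using assms(3) ent_impI ent_mp by blast
  thus "ent s (FNot \<psi> # \<Gamma>) FBot" using ent_weaken1[OF assms(1)] ent_mp by blast
qed (use assms in auto)

text \<open>Lets a doubly negated disjunction or existential be used as if it were plain, as long as
  the goal is stable.\<close>

lemma ent_nnE:
  assumes "ent s \<Gamma> (FNot (FNot \<phi>))" "ent s (\<phi> # \<Gamma>) \<psi>" "fm_in s \<phi>" "stable s \<psi>"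
  shows "ent s \<Gamma> \<psi>"
  using ent_nn_mono[OF assms(1,2,3)] assms(4) stableD by (auto simp: stable_def)

lemma stable_bot: "stable s FBot"
proof (rule stableI)
  have "ent s [FNot (FNot FBot)] (FNot FBot)" by (intro ent_impI ent_hyp) auto
  thus "ent s [FNot (FNot FBot)] FBot" by (rule ent_mp[rotated]) (simp add: ent_hyp)
qed simp

text \<open>Stability of the consequent suffices: under the antecedent, the doubly negated
  implication can be applied by \<open>ent_nnE\<close>.\<close>

lemma stable_imp:
  assumes "stable s \<psi>" "fm_in s \<phi>"
  shows "stable s (\<phi> \<^bold>\<longrightarrow> \<psi>)"
proof (rule stableI)
  let ?\<Gamma> = "[\<phi>, FNot (FNot (\<phi> \<^bold>\<longrightarrow> \<psi>))]"
  have "ent s ((\<phi> \<^bold>\<longrightarrow> \<psi>) # ?\<Gamma>) \<psi>" by (rule ent_mp[of _ _ \<phi>]) (auto intro: ent_hyp)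
  hence "ent s ?\<Gamma> \<psi>"
    by (rule ent_nnE[rotated]) (use assms in \<open>auto simp: stable_def intro: ent_hyp\<close>)
  thus "ent s [FNot (FNot (\<phi> \<^bold>\<longrightarrow> \<psi>))] (\<phi> \<^bold>\<longrightarrow> \<psi>)" using assms(2) by (rule ent_impI[rotated])
qed (use assms in \<open>auto simp: stable_def\<close>)

lemma stable_not: "fm_in s \<phi> \<Longrightarrow> stable s (FNot \<phi>)"
  by (rule stable_imp[OF stable_bot])

lemma stable_and:
  assumes "stable s \<phi>" "stable s \<psi>"
  shows "stable s (\<phi> \<^bold>\<and> \<psi>)"
proof (rule stableI)
  let ?\<Gamma> = "[FNot (FNot (\<phi> \<^bold>\<and> \<psi>))]"
  have *: "ent s ?\<Gamma> (FNot (FNot (\<phi> \<^bold>\<and> \<psi>)))" by (auto intro: ent_hyp)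
  have "ent s ((\<phi> \<^bold>\<and> \<psi>) # ?\<Gamma>) (\<phi> \<^bold>\<and> \<psi>)" by (auto intro: ent_hyp)
  hence **: "ent s ((\<phi> \<^bold>\<and> \<psi>) # ?\<Gamma>) \<phi>" "ent s ((\<phi> \<^bold>\<and> \<psi>) # ?\<Gamma>) \<psi>"
    by (simp_all add: ent_and_iff)
  have "ent s ?\<Gamma> \<phi>" "ent s ?\<Gamma> \<psi>"
    using ent_nnE[OF * **(1)] ent_nnE[OF * **(2)] assms by (auto simp: stable_def)
  thus "ent s ?\<Gamma> (\<phi> \<^bold>\<and> \<psi>)" by (rule ent_andI)
qed (use assms in \<open>auto simp: stable_def\<close>)

lemma stable_all:
  assumes "stable s \<phi>" "ty_le (fst x) s"
  shows "stable s (FAll x \<phi>)"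
proof (rule stableI)
  let ?\<Gamma> = "[FNot (FNot (FAll x \<phi>))]"
  have "ent s (FAll x \<phi> # ?\<Gamma>) (subst x (V x) \<phi>)" by (rule ent_allE) (auto intro: ent_hyp)
  hence *: "ent s (FAll x \<phi> # ?\<Gamma>) \<phi>" by simp
  have "ent s ?\<Gamma> \<phi>"
    by (rule ent_nnE[OF ent_hyp *]) (use assms in \<open>auto simp: stable_def intro: ent_hyp\<close>)
  thus "ent s ?\<Gamma> (FAll x \<phi>)" using assms(2) by (rule ent_allI) auto
qed (use assms in \<open>auto simp: stable_def\<close>)

section \<open>The negative translation of formulas\<close>

lemma cneg_cases: "cneg n = Zero \<or> (\<exists>m. cneg n = cC m)"
  by (subst (1 2) cneg.simps) (auto split: prod.splits)

text \<open>By \<open>cneg_cases\<close> a comprehension constant goes to another one or to the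
  number 0, and in the latter case \<open>ttrans\<close> puts the type-0 variable.\<close>

lemma tyof_ttrans [simp]: "fst v = Ty 0 \<Longrightarrow> tyof (ttrans cneg v a) = tyof a"
proof (cases a)
  case (Cst d)
  thus "fst v = Ty 0 \<Longrightarrow> ?thesis" by (cases d) (use cneg_cases in force)+
qed auto

lemma tv_ttrans: "tv (ttrans c v a) = tv a \<or> (tv (ttrans c v a) = {v} \<and> tv a = {})"
  by (cases "(c, v, a)" rule: ttrans.cases) auto

lemma ttrans_notin: "v \<notin> tv (ttrans c v a) \<Longrightarrow> ttrans c w a = ttrans c v a"
  by (cases "(c, v, a)" rule: ttrans.cases) (auto split: if_splits)

lemma tsubst_ttrans: "v \<notin> tv a \<Longrightarrow> tsubst v (V w) (ttrans c v a) = ttrans c w a"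
  by (cases "(c, v, a)" rule: ttrans.cases) auto

text \<open>Treats the three atomic clauses as one; \<open>neg.simps(1-3)\<close> is therefore kept
  away from the simplifier in the inductions below.\<close>

lemma neg_atomic:
  "atomic A \<Longrightarrow> neg c A =
    FNot (FNot (with_zero (new (fv A)) (map_fm (ttrans c (new (fv A))) A)))"
  by (cases A) (simp_all add: Let_def)

lemma fm_in_map_fm [simp]: "(\<And>a. tyof (f a) = tyof a) \<Longrightarrow> fm_in s (map_fm f \<phi>) = fm_in s \<phi>"
  by (induction \<phi>) auto

lemma new_notin_fv [simp]: "new (fv A) \<notin> fv A"
  by (rule new_notin) simp

lemma fm_in_neg [simp]: "fm_in s (neg cneg \<phi>) = fm_in s \<phi>"
proof -
  have "fm_in s (neg cneg A) = fm_in s A" if "atomic A" for A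
    using that by (simp add: neg_atomic with_zero_def)
  thus ?thesis by (induction \<phi>) (auto simp del: neg.simps(1-3))
qed

lemma fv_map_fm_ttrans:
  assumes "atomic A" "v \<notin> fv A"
  shows "fv (map_fm (ttrans c v) A) - {v} = fv A"
proof -
  have "tv (ttrans c v a) - {v} = tv a" if "v \<notin> tv a" for a using tv_ttrans[of c v a] that by auto
  thus ?thesis using assms by (cases A) (auto simp: Un_Diff)
qed

text \<open>\<open>with_zero\<close> binds the auxiliary variable whenever it occurs. Eigenvariable
  conditions and the parameter condition of comprehension therefore carry over.\<close>

lemma fv_neg [simp]: "fv (neg c \<phi>) = fv \<phi>"
proof -
  have "fv (neg c A) = fv A" if "atomic A" for A
  proof -
    define v where "v = new (fv A)"
    have "fv (map_fm (ttrans c v) A) - {v} = fv A" using that by (simp add: fv_map_fm_ttrans v_def)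
    moreover have "fv (with_zero v B) = fv B - {v}" for B by (auto simp: with_zero_def)
    ultimately show ?thesis unfolding neg_atomic[OF that] v_def[symmetric] by simp
  qed
  thus ?thesis by (induction \<phi>) (auto simp del: neg.simps(1-3))
qed

text \<open>The added quantifier has type 0 and the added equality compares with a number, so
  neither is of type \<open>Suc k\<close>.\<close>

lemma elementary_neg:
  assumes "elementary (Suc k) \<phi>"
  shows "elementary (Suc k) (neg cneg \<phi>)"
proof -
  have "no_top (Suc k) (neg cneg A) = no_top (Suc k) A" if "atomic A" for A
  proof -
    have "no_top (Suc k) (with_zero v B) = no_top (Suc k) B" if "fst v = Ty 0" for v B
      using that by (simp add: with_zero_def)
    moreover have "no_top (Suc k) (map_fm f A) = no_top (Suc k) A" for f
      using that by (cases A) auto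
    ultimately show ?thesis by (simp add: neg_atomic[OF that])
  qed
  hence "no_top (Suc k) (neg cneg \<phi>) = no_top (Suc k) \<phi>"
    by (induction \<phi>) (auto simp del: neg.simps(1-3))
  thus ?thesis using assms by (auto simp: elementary_def)
qed

text \<open>Atoms, disjunctions and existentials are translated into negations, which are stable;
  the other connectives preserve stability.\<close>

lemma stable_neg: "fm_in s \<phi> \<Longrightarrow> stable s (neg cneg \<phi>)"
proof -
  have "stable s (neg cneg A)" if "atomic A" "fm_in s A" for A
    using fm_in_neg[of s A] that(2) unfolding neg_atomic[OF that(1)] by (intro stable_not) simp
  thus "fm_in s \<phi> \<Longrightarrow> ?thesis"
    by (induction \<phi>)
      (auto simp del: neg.simps(1-3) intro: stable_bot stable_and stable_imp stable_not stable_all)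
qed

text \<open>A fixed name \<open>z\<close> of \<open>0\<close> replaces the quantified ones that the translation introduces.\<close>

lemma with_zero_iff:
  assumes A: "atomic A" "fm_in s A" and z: "fst z = Ty 0" "z \<notin> bv (neg cneg A)"
  defines "v \<equiv> new (fv A)"
  shows "ent s [Eq Om (V z) (Cst Zero)]
    (with_zero v (map_fm (ttrans cneg v) A) \<^bold>\<longleftrightarrow> map_fm (ttrans cneg z) A)"
proof (cases "v \<in> fv (map_fm (ttrans cneg v) A)")
  case False
  hence "map_fm (ttrans cneg v) A = map_fm (ttrans cneg z) A"
    using A(1) by (cases A) (auto simp: ttrans_notin[of v _ _ z])
  moreover have "fm_in s (map_fm (ttrans cneg z) A)" using A(2) z(1) by simp
  ultimately show ?thesis using False by (simp add: with_zero_def ent_iff_refl)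
next
  case True
  let ?Z = "\<lambda>v. Eq Om (V v) (Cst Zero)" and ?A = "\<lambda>v. map_fm (ttrans cneg v) A"
  have v: "fst v = Ty 0" "v \<notin> fv A" unfolding v_def by simp_all
  \<comment> \<open>Since \<open>v\<close> occurs, \<open>with_zero\<close> binds it, and
    \<open>z\<close> avoids the bound variables of the translation.\<close>
  have zv: "z \<noteq> v" using z True A by (auto simp: neg_atomic with_zero_def v_def)
  have "v \<notin> tv (ttrans cneg z a)" if "v \<notin> tv a" for a
    using tv_ttrans[of cneg z a] zv that by auto
  hence fv: "v \<notin> fv (?A z)" using A(1) v(2) by (cases A) auto
  have "ent s [?A z, ?Z z] (FEx v (?Z v \<^bold>\<and> ?A v))"
  proof (rule ent_exI)
    have "subst v (V z) (?A v) = ?A z"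
      using A(1) v(2) by (cases A) (auto simp: tsubst_ttrans)
    thus "ent s [?A z, ?Z z] (subst v (V z) (?Z v \<^bold>\<and> ?A v))"
      by (simp add: ent_and_iff ent_hyp)
    show "free_for (V z) v (?Z v \<^bold>\<and> ?A v)" using A(1) by (cases A) auto
  qed (use v z in auto)
  moreover have "ent s [FEx v (?Z v \<^bold>\<and> ?A v), ?Z z] (?A z)"
  proof (rule ent_exE)
    let ?\<Gamma> = "[?Z v \<^bold>\<and> ?A v, FEx v (?Z v \<^bold>\<and> ?A v), ?Z z]"
    have "ent s ?\<Gamma> (?Z v \<^bold>\<and> ?A v)" by (auto intro: ent_hyp)
    hence h: "ent s ?\<Gamma> (?Z v)" "ent s ?\<Gamma> (?A v)" by (simp_all add: ent_and_iff)
    have "ent s ?\<Gamma> (?Z z)" by (auto intro: ent_hyp)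
    \<comment> \<open>Two names of the same number are equal.\<close>
    hence vz: "ent s ?\<Gamma> (Eq (Ty 0) (V v) (V z))" using h(1) ent_num_eq by blast
    show "ent s ?\<Gamma> (?A z)"
    proof (rule ent_map_fm[OF A(1) h(2)])
      have "co_named s ?\<Gamma> (V v) (V z)"
        unfolding co_named_def using vz v(1) z(1) ent_refl[of "V v" s ?\<Gamma>] by auto
      thus "co_named s ?\<Gamma> (ttrans cneg v a) (ttrans cneg z a)" for a
        by (cases "(cneg, v, a)" rule: ttrans.cases) (auto simp: co_named_def)
    qed (use A v in simp)
  qed (use fv zv in \<open>auto intro: ent_hyp\<close>)
  ultimately show ?thesis using True A v z
    by (auto simp: with_zero_def intro!: ent_andI ent_impI)
qed

text \<open>Substitution commutes with the translation only up to the choice of bound variables, and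
  \<open>ttrans cneg z t\<close> need not be free for \<open>x\<close> in the translation. Both problems disappear when the
  substitution of \<open>t\<close> for \<open>x\<close> is replaced by the assumption that \<open>w\<close> is a common name of them.\<close>

lemma neg_subst:
  assumes "fm_in s \<phi>" "free_for t x \<phi>" "tyof t = fst x" "x \<notin> tv t" "fst z = Ty 0" "fst w = Ty 0"
    "z \<notin> bv (neg cneg \<phi>) \<union> bv (neg cneg (subst x t \<phi>))" "w \<notin> bv (neg cneg \<phi>)"
    "\<phi>' = subst x t \<phi>"
  shows "ent s [Eq Om (V z) (Cst Zero), Eq (fst x) (V w) (V x), Eq (fst x) (V w) (ttrans cneg z t)]
    (neg cneg \<phi> \<^bold>\<longleftrightarrow> neg cneg \<phi>')" (is "ent s ?\<Gamma> _")
proof -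
  \<comment> \<open>At an atom both translations are reduced to the fixed name \<open>z\<close> of
    0, where they differ only in co-named terms.\<close>
  have at: "ent s ?\<Gamma> (neg cneg A \<^bold>\<longleftrightarrow> neg cneg (subst x t A))"
    if A: "atomic A" "fm_in s A" "z \<notin> bv (neg cneg A)" "z \<notin> bv (neg cneg (subst x t A))" for A
  proof -
    let ?W = "\<lambda>A. with_zero (new (fv A)) (map_fm (ttrans cneg (new (fv A))) A)"
    let ?A = "map_fm (ttrans cneg z) A" and ?B = "map_fm (ttrans cneg z) (subst x t A)"
    have "atomic (subst x t A)" using A(1) by (cases A) simp_all
    moreover have "fm_in s (subst x t A)" using A(2) assms(3) by simp
    ultimately have B: "atomic (subst x t A)" "fm_in s (subst x t A)" .
    have AW: "ent s ?\<Gamma> (?W A \<^bold>\<longleftrightarrow> ?A)" and BW: "ent s ?\<Gamma> (?W (subst x t A) \<^bold>\<longleftrightarrow> ?B)"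
      by (rule ent_weaken[OF with_zero_iff]; use A B assms in simp)+
    have eq: "?B = map_fm (\<lambda>a. ttrans cneg z (tsubst x t a)) A" using A(1) by (cases A) auto
    \<comment> \<open>\<open>w\<close> names \<open>x\<close> as well as the translated
      \<open>t\<close>; every other term is left alone by the substitution.\<close>
    have co_named: "co_named s \<Delta> (ttrans cneg z a) (ttrans cneg z (tsubst x t a))"
      if "set ?\<Gamma> \<subseteq> set \<Delta>" for a \<Delta>
    proof (cases "a = V x")
      case True
      thus ?thesis using that assms by (auto simp: co_named_def intro: ent_hyp)
    qed (cases a, auto simp: co_named_def)
    have ty: "tyof (tsubst x t a) = tyof a" for a using assms by (cases a) auto
    have "ent s \<Delta> ?A \<longleftrightarrow> ent s \<Delta> ?B" if "set ?\<Gamma> \<subseteq> set \<Delta>" for \<Delta>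
    proof
      show "ent s \<Delta> ?B" if "ent s \<Delta> ?A"
        unfolding eq by (rule ent_map_fm[OF A(1) that _ co_named]) (fact | use A assms in simp)+
      show "ent s \<Delta> ?A" if "ent s \<Delta> ?B"
        by (rule ent_map_fm[OF A(1) that[unfolded eq] _ co_named_sym[OF co_named]])
          (fact | use A assms ty in simp)+
    qed
    hence AB: "ent s ?\<Gamma> (?A \<^bold>\<longleftrightarrow> ?B)" using A B assms(5) by (intro ent_iffI) auto
    have wf: "fm_in s (?W A)" "fm_in s (?W (subst x t A))"
      using A B fm_in_neg[of s A] fm_in_neg[of s "subst x t A"] by (simp_all add: neg_atomic)
    from A(2) B(2) assms(5) have "ent s ?\<Gamma> (?W A \<^bold>\<longleftrightarrow> ?W (subst x t A))"
      by (intro ent_iff_trans[OF _ _ AW ent_iff_trans[OF _ _ AB ent_iff_sym[OF BW]]] wf) simp_all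
    with wf show ?thesis using A(1) B(1) by (simp add: neg_atomic ent_nn_cong)
  qed
  have not_free: "ent s ?\<Gamma> (neg cneg \<chi> \<^bold>\<longleftrightarrow> neg cneg \<chi>)" if "fm_in s \<chi>" for \<chi>
    using that by (simp add: ent_iff_refl)
  \<comment> \<open>A quantifier on \<open>y\<close> with \<open>x\<close> free below it meets these
    conditions: \<open>free_for\<close> keeps \<open>y\<close> out of \<open>t\<close>, and
    \<open>z\<close> and \<open>w\<close> avoid the bound variables of the translation. This is what
    the quantifier congruences require.\<close>
  have bound: "y \<notin> fv (Conj ?\<Gamma>)" if "y \<noteq> x" "y \<noteq> z" "y \<noteq> w" "y \<notin> tv t" for y
    using that tv_ttrans[of cneg z t] by auto
  show ?thesis using assms(1,2,7,8) unfolding assms(9)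
  proof (induction \<phi>)
    case (Ap a b c)
    thus ?case by (intro at) auto
  next
    case (Eq \<tau> a b)
    thus ?case by (intro at) auto
  next
    case (Mem k a b)
    thus ?case by (intro at) auto
  next
    case (FAll y \<phi>)
    show ?case
    proof (cases "x \<in> fv (FAll y \<phi>)")
      case True
      thus ?thesis using FAll assms(3) bound[of y] by (auto intro!: ent_all_cong)
    next
      case False
      from FAll.prems(1) show ?thesis unfolding subst_notin[OF False] by (rule not_free)
    qed
  next
    case (FEx y \<phi>)
    show ?case
    proof (cases "x \<in> fv (FEx y \<phi>)")
      case True
      thus ?thesis using FEx assms(3) bound[of y] by (auto intro!: ent_nn_cong ent_ex_cong)
    next
      case False
      from FEx.prems(1) show ?thesis unfolding subst_notin[OF False] by (rule not_free)
    qed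
  qed (use assms(3) in \<open>auto intro!: ent_iff_refl ent_and_cong ent_or_cong ent_nn_cong ent_imp_cong\<close>)
qed

section \<open>Positive formulas and the axioms\<close>

lemma BT_imp_iff: "fm_in s \<phi> \<Longrightarrow> BT s (\<phi> \<^bold>\<longrightarrow> \<psi>) \<longleftrightarrow> ent s [\<phi>] \<psi>"
  using ent_imp_iff[of s \<phi> "[]" \<psi>] by simp

lemma BT_all_mono:
  assumes "BT s (\<phi> \<^bold>\<longrightarrow> \<psi>)" "ty_le (fst x) s"
  shows "BT s (FAll x \<phi> \<^bold>\<longrightarrow> FAll x \<psi>)"
proof -
  have wf: "fm_in s \<phi>" using deriv_fm_in[OF assms(1)] by simp
  have "ent s [FAll x \<phi>] (subst x (V x) \<phi>)" by (rule ent_allE) (auto intro: ent_hyp)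
  hence "ent s [FAll x \<phi>] \<psi>" using assms(1) by (auto intro: ent_mp ent_thm)
  thus ?thesis using assms(2) wf by (auto simp: BT_imp_iff intro: ent_allI)
qed

lemma BT_ex_mono:
  assumes "BT s (\<phi> \<^bold>\<longrightarrow> \<psi>)" "ty_le (fst x) s"
  shows "BT s (FEx x \<phi> \<^bold>\<longrightarrow> FEx x \<psi>)"
proof -
  have "fm_in s \<psi>" using deriv_fm_in[OF assms(1)] by simp
  hence "BT s (subst x (V x) \<psi> \<^bold>\<longrightarrow> FEx x \<psi>)"
    using assms(2) by (intro logic logic_axiom.ExI) auto
  hence "BT s (\<phi> \<^bold>\<longrightarrow> FEx x \<psi>)" using assms(1) BT_trans by auto
  thus ?thesis using assms(2) by (rule ExE) simp
qed

fun positive :: "fm \<Rightarrow> bool" where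
  "positive (\<phi> \<^bold>\<and> \<psi>) = (positive \<phi> \<and> positive \<psi>)"
| "positive (\<phi> \<^bold>\<or> \<psi>) = (positive \<phi> \<and> positive \<psi>)"
| "positive (\<phi> \<^bold>\<longrightarrow> \<psi>) = False"
| "positive (FAll x \<phi>) = False"
| "positive (FEx x \<phi>) = positive \<phi>"
| "positive _ = True"

lemma ent_nn_bind:
  assumes "ent s \<Gamma> (FNot (FNot \<phi>))" "ent s (\<phi> # \<Gamma>) (FNot (FNot \<psi>))" "fm_in s \<phi>" "fm_in s \<psi>"
  shows "ent s \<Gamma> (FNot (FNot \<psi>))"
  using assms by (intro ent_nnE[OF assms(1)] stable_not) auto

lemma BT_nn_mono:
  assumes "BT s (\<phi> \<^bold>\<longrightarrow> \<psi>)"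
  shows "BT s (FNot (FNot \<phi>) \<^bold>\<longrightarrow> FNot (FNot \<psi>))"
proof -
  have wf: "fm_in s \<phi>" "fm_in s \<psi>" using deriv_fm_in[OF assms] by auto
  have "ent s [\<phi>, FNot (FNot \<phi>)] \<psi>"
    using ent_mp[OF ent_thm[OF assms]] by (simp add: ent_hyp)
  hence "ent s [FNot (FNot \<phi>)] (FNot (FNot \<psi>))"
    using wf ent_nn_mono[OF ent_hyp] by auto
  thus ?thesis using wf by (simp add: BT_imp_iff)
qed

lemma BT_nn_bind:
  assumes "BT s (\<phi> \<^bold>\<longrightarrow> FNot (FNot \<psi>))"
  shows "BT s (FNot (FNot \<phi>) \<^bold>\<longrightarrow> FNot (FNot \<psi>))"
proof -
  have "fm_in s \<psi>" using deriv_fm_in[OF assms] by auto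
  hence "BT s (FNot (FNot (FNot (FNot \<psi>))) \<^bold>\<longrightarrow> FNot (FNot \<psi>))"
    using stable_not[of s "FNot \<psi>"] by (simp add: stable_def)
  thus ?thesis using BT_nn_mono[OF assms] BT_trans by blast
qed

lemma BT_nnI: "fm_in s \<phi> \<Longrightarrow> BT s (\<phi> \<^bold>\<longrightarrow> FNot (FNot \<phi>))"
  by (simp add: BT_imp_iff ent_nnI ent_hyp)

text \<open>No constant becomes 0, so the replacement variable never occurs and its choice is
  immaterial.\<close>

lemma neg_atomic_nonzero:
  assumes "atomic A" "\<And>n. n \<in> fconsts A \<Longrightarrow> c n \<noteq> Zero"
  shows "neg c A = FNot (FNot (map_fm (ttrans c v) A))"
proof -
  have eq: "ttrans c w a = ttrans c v a" if "\<And>n. n \<in> tconsts a \<Longrightarrow> c n \<noteq> Zero" for w a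
    using that by (cases "(c, w, a)" rule: ttrans.cases) auto
  have "tv (ttrans c w a) = tv a" if "\<And>n. n \<in> tconsts a \<Longrightarrow> c n \<noteq> Zero" for w a
    using that by (cases "(c, w, a)" rule: ttrans.cases) auto
  hence fv: "fv (map_fm (ttrans c w) A) = fv A" for w
    using assms by (cases A) auto
  define u where "u = new (fv A)"
  have "map_fm (ttrans c u) A = map_fm (ttrans c v) A"
    using assms eq[of _ u] by (cases A) auto
  moreover have "with_zero u (map_fm (ttrans c u) A) = map_fm (ttrans c u) A"
    using new_notin_fv[of A] by (simp add: with_zero_def fv u_def[symmetric])
  ultimately show ?thesis unfolding neg_atomic[OF assms(1)] u_def[symmetric] by simp
qed

text \<open>Together with stability the two halves make \<open>neg cneg \<phi>\<close> equivalent to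
  the double negation of \<open>\<rho> \<phi>\<close>. For a universal quantifier the second half
  would be the double negation shift; for a constant sent to 0, \<open>\<rho>\<close> would insert
  the free variable \<open>v\<close>.\<close>

lemma positive_neg:
  assumes "positive \<phi>" "fm_in s \<phi>" "\<And>n. n \<in> fconsts \<phi> \<Longrightarrow> cneg n \<noteq> Zero" "fst v = Ty 0"
  defines "\<rho> \<equiv> map_fm (ttrans cneg v)"
  shows "BT s (\<rho> \<phi> \<^bold>\<longrightarrow> neg cneg \<phi>) \<and> BT s (neg cneg \<phi> \<^bold>\<longrightarrow> FNot (FNot (\<rho> \<phi>)))"
  using assms(1-3)
proof (induction \<phi>)
  case (Ap a b c)
  let ?A = "Ap a b c"
  have "fm_in s (\<rho> ?A)" using Ap(2) assms(4) by (simp add: \<rho>_def)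
  thus ?case unfolding \<rho>_def using Ap(3)
    by (subst (1 2) neg_atomic_nonzero[where v = v]) (auto intro!: BT_nnI BT_refl simp del: map_fm.simps)
next
  case (Eq \<tau> a b)
  let ?A = "Eq \<tau> a b"
  have "fm_in s (\<rho> ?A)" using Eq(2) assms(4) by (simp add: \<rho>_def)
  thus ?case unfolding \<rho>_def using Eq(3)
    by (subst (1 2) neg_atomic_nonzero[where v = v]) (auto intro!: BT_nnI BT_refl simp del: map_fm.simps)
next
  case (Mem k a b)
  let ?A = "Mem k a b"
  have "fm_in s (\<rho> ?A)" using Mem(2) assms(4) by (simp add: \<rho>_def)
  thus ?case unfolding \<rho>_def using Mem(3)
    by (subst (1 2) neg_atomic_nonzero[where v = v]) (auto intro!: BT_nnI BT_refl simp del: map_fm.simps)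
next
  case FBot
  show ?case by (auto simp: \<rho>_def intro!: BT_nnI BT_refl)
next
  case (FAnd \<phi> \<psi>)
  have wf: "fm_in s (\<rho> \<phi>)" "fm_in s (\<rho> \<psi>)" using FAnd.prems(2) assms(4) by (simp_all add: \<rho>_def)
  have wf': "fm_in s (neg cneg \<phi>)" "fm_in s (neg cneg \<psi>)" using FAnd.prems(2) by simp_all
  have IH: "BT s (\<rho> \<phi> \<^bold>\<longrightarrow> neg cneg \<phi>)" "BT s (neg cneg \<phi> \<^bold>\<longrightarrow> FNot (FNot (\<rho> \<phi>)))"
    "BT s (\<rho> \<psi> \<^bold>\<longrightarrow> neg cneg \<psi>)" "BT s (neg cneg \<psi> \<^bold>\<longrightarrow> FNot (FNot (\<rho> \<psi>)))"
    using FAnd by auto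
  have "ent s [\<rho> \<phi> \<^bold>\<and> \<rho> \<psi>] (\<rho> \<phi> \<^bold>\<and> \<rho> \<psi>)" by (rule ent_hyp) simp
  hence "ent s [\<rho> \<phi> \<^bold>\<and> \<rho> \<psi>] (neg cneg \<phi> \<^bold>\<and> neg cneg \<psi>)"
    unfolding ent_and_iff using ent_mp[OF ent_thm] IH by blast
  moreover have "ent s [neg cneg \<phi> \<^bold>\<and> neg cneg \<psi>] (FNot (FNot (\<rho> \<phi> \<^bold>\<and> \<rho> \<psi>)))"
  proof -
    let ?\<Gamma> = "[neg cneg \<phi> \<^bold>\<and> neg cneg \<psi>]"
    have "ent s ?\<Gamma> (neg cneg \<phi> \<^bold>\<and> neg cneg \<psi>)" by (rule ent_hyp) simp
    hence nn: "ent s ?\<Gamma> (FNot (FNot (\<rho> \<phi>)))" "ent s ?\<Gamma> (FNot (FNot (\<rho> \<psi>)))"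
      unfolding ent_and_iff using ent_mp[OF ent_thm] IH by blast+
    have "ent s (\<rho> \<psi> # \<rho> \<phi> # ?\<Gamma>) (\<rho> \<phi> \<^bold>\<and> \<rho> \<psi>)" by (simp add: ent_and_iff ent_hyp)
    hence "ent s (\<rho> \<phi> # ?\<Gamma>) (FNot (FNot (\<rho> \<phi> \<^bold>\<and> \<rho> \<psi>)))"
      using ent_nn_mono[OF ent_weaken1[OF nn(2)]] wf by simp
    thus ?thesis using ent_nn_bind[OF nn(1)] wf by simp
  qed
  ultimately show ?case using wf wf' by (simp add: BT_imp_iff \<rho>_def)
next
  case (FOr \<phi> \<psi>)
  have wf: "fm_in s (\<rho> \<phi>)" "fm_in s (\<rho> \<psi>)" using FOr.prems(2) assms(4) by (simp_all add: \<rho>_def)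
  have wf': "fm_in s (neg cneg \<phi>)" "fm_in s (neg cneg \<psi>)" using FOr.prems(2) by simp_all
  have IH: "BT s (\<rho> \<phi> \<^bold>\<longrightarrow> neg cneg \<phi>)" "BT s (neg cneg \<phi> \<^bold>\<longrightarrow> FNot (FNot (\<rho> \<phi>)))"
    "BT s (\<rho> \<psi> \<^bold>\<longrightarrow> neg cneg \<psi>)" "BT s (neg cneg \<psi> \<^bold>\<longrightarrow> FNot (FNot (\<rho> \<psi>)))"
    using FOr by auto
  have "BT s ((\<rho> \<phi> \<^bold>\<or> \<rho> \<psi>) \<^bold>\<longrightarrow> (neg cneg \<phi> \<^bold>\<or> neg cneg \<psi>))"
  proof -
    let ?\<Gamma> = "[\<rho> \<phi> \<^bold>\<or> \<rho> \<psi>]"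
    have "ent s (\<rho> \<phi> # ?\<Gamma>) (neg cneg \<phi>)" "ent s (\<rho> \<psi> # ?\<Gamma>) (neg cneg \<psi>)"
      using ent_mp[OF ent_thm[OF IH(1)]] ent_mp[OF ent_thm[OF IH(3)]] by (simp_all add: ent_hyp)
    hence "ent s (\<rho> \<phi> # ?\<Gamma>) (neg cneg \<phi> \<^bold>\<or> neg cneg \<psi>)"
      "ent s (\<rho> \<psi> # ?\<Gamma>) (neg cneg \<phi> \<^bold>\<or> neg cneg \<psi>)"
      using wf' by (auto intro: ent_orI1 ent_orI2)
    hence "ent s ?\<Gamma> (neg cneg \<phi> \<^bold>\<or> neg cneg \<psi>)" by (rule ent_orE[rotated]) (simp add: ent_hyp)
    thus ?thesis using wf by (simp add: BT_imp_iff)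
  qed
  hence "BT s ((\<rho> \<phi> \<^bold>\<or> \<rho> \<psi>) \<^bold>\<longrightarrow> FNot (FNot (neg cneg \<phi> \<^bold>\<or> neg cneg \<psi>)))"
    using BT_trans BT_nnI wf' by (meson fm_in.simps(6))
  moreover have "BT s ((neg cneg \<phi> \<^bold>\<or> neg cneg \<psi>) \<^bold>\<longrightarrow> FNot (FNot (\<rho> \<phi> \<^bold>\<or> \<rho> \<psi>)))"
  proof -
    let ?\<Gamma> = "[neg cneg \<phi> \<^bold>\<or> neg cneg \<psi>]"
    have "BT s (FNot (FNot (\<rho> \<phi>)) \<^bold>\<longrightarrow> FNot (FNot (\<rho> \<phi> \<^bold>\<or> \<rho> \<psi>)))"
      "BT s (FNot (FNot (\<rho> \<psi>)) \<^bold>\<longrightarrow> FNot (FNot (\<rho> \<phi> \<^bold>\<or> \<rho> \<psi>)))"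
      using wf by (auto intro!: BT_nn_mono logic intro: logic_axiom.intros)
    hence "BT s (neg cneg \<phi> \<^bold>\<longrightarrow> FNot (FNot (\<rho> \<phi> \<^bold>\<or> \<rho> \<psi>)))"
      "BT s (neg cneg \<psi> \<^bold>\<longrightarrow> FNot (FNot (\<rho> \<phi> \<^bold>\<or> \<rho> \<psi>)))"
      using IH BT_trans by blast+
    hence "ent s (neg cneg \<phi> # ?\<Gamma>) (FNot (FNot (\<rho> \<phi> \<^bold>\<or> \<rho> \<psi>)))"
      "ent s (neg cneg \<psi> # ?\<Gamma>) (FNot (FNot (\<rho> \<phi> \<^bold>\<or> \<rho> \<psi>)))"
      using ent_mp[OF ent_thm] by (auto simp: ent_hyp)
    hence "ent s ?\<Gamma> (FNot (FNot (\<rho> \<phi> \<^bold>\<or> \<rho> \<psi>)))"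
      by (rule ent_orE[rotated]) (simp add: ent_hyp)
    thus ?thesis using wf' by (simp add: BT_imp_iff)
  qed
  ultimately show ?case by (simp add: \<rho>_def BT_nn_bind)
next
  case (FEx x \<phi>)
  have x: "ty_le (fst x) s" using FEx.prems(2) by simp
  have IH: "BT s (\<rho> \<phi> \<^bold>\<longrightarrow> neg cneg \<phi>)" "BT s (neg cneg \<phi> \<^bold>\<longrightarrow> FNot (FNot (\<rho> \<phi>)))"
    using FEx by auto
  have "BT s (FEx x (\<rho> \<phi>) \<^bold>\<longrightarrow> FNot (FNot (FEx x (neg cneg \<phi>))))"
    using BT_trans[OF BT_ex_mono[OF IH(1) x] BT_nnI] FEx.prems(2) by simp
  moreover have "BT s (neg cneg \<phi> \<^bold>\<longrightarrow> FNot (FNot (FEx x (\<rho> \<phi>))))"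
  proof -
    have "fm_in s (\<rho> \<phi>)" using FEx.prems(2) assms(4) by (simp add: \<rho>_def)
    hence "BT s (subst x (V x) (\<rho> \<phi>) \<^bold>\<longrightarrow> FEx x (\<rho> \<phi>))"
      using x by (intro logic logic_axiom.ExI) auto
    thus ?thesis using IH(2) BT_nn_mono BT_trans by auto
  qed
  hence "BT s (FEx x (neg cneg \<phi>) \<^bold>\<longrightarrow> FNot (FNot (FEx x (\<rho> \<phi>))))" using x by (rule ExE) simp
  ultimately show ?case by (simp add: \<rho>_def BT_nn_bind)
qed simp_all

lemma map_fm_ttrans_id: "fconsts \<phi> = {} \<Longrightarrow> map_fm (ttrans c v) \<phi> = \<phi>"
proof -
  have "tconsts a = {} \<Longrightarrow> ttrans c v a = a" for a by (cases "(c, v, a)" rule: ttrans.cases) auto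
  thus "fconsts \<phi> = {} \<Longrightarrow> ?thesis" by (induction \<phi>) auto
qed

lemma positive_neg_id:
  assumes "positive \<phi>" "fm_in s \<phi>" "fconsts \<phi> = {}"
  shows "BT s (\<phi> \<^bold>\<longrightarrow> neg cneg \<phi>)" "BT s (neg cneg \<phi> \<^bold>\<longrightarrow> FNot (FNot \<phi>))"
  using positive_neg[OF assms(1,2), of "(Ty 0, 0)"] map_fm_ttrans_id[OF assms(3)] assms(3) by auto

lemma BT_neg_positive:
  "BT s \<phi> \<Longrightarrow> positive \<phi> \<Longrightarrow> fconsts \<phi> = {} \<Longrightarrow> BT s (neg cneg \<phi>)"
  using positive_neg_id MP deriv_fm_in by blast

text \<open>Passes from \<open>neg cneg \<phi>\<close> to \<not>\<not>\<phi>, from there to the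
  double negation of \<open>neg cneg \<psi>\<close>, which stability removes.\<close>

lemma BT_neg_imp:
  assumes "BT s (\<phi> \<^bold>\<longrightarrow> \<psi>)" "positive \<phi>" "fconsts \<phi> = {}" "positive \<psi>" "fconsts \<psi> = {}"
  shows "BT s (neg cneg \<phi> \<^bold>\<longrightarrow> neg cneg \<psi>)"
proof -
  have wf: "fm_in s \<phi>" "fm_in s \<psi>" using deriv_fm_in[OF assms(1)] by auto
  have "BT s (FNot (FNot \<phi>) \<^bold>\<longrightarrow> FNot (FNot (neg cneg \<psi>)))"
    using BT_trans[OF assms(1) positive_neg_id(1)] assms wf by (intro BT_nn_mono) auto
  moreover have "BT s (FNot (FNot (neg cneg \<psi>)) \<^bold>\<longrightarrow> neg cneg \<psi>)"
    using stable_neg[OF wf(2)] by (simp add: stable_def)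
  ultimately show ?thesis using positive_neg_id(2) assms wf BT_trans by blast
qed

text \<open>Made for \<open>d_neq\<close>, whose hypothesis is a negation: contraposing the first
  half of \<open>positive_neg\<close> turns a negated translation into a plain negation.\<close>

lemma BT_neg_not_imp:
  assumes "BT s (FNot \<phi> \<^bold>\<longrightarrow> \<psi>)" "positive \<phi>" "fconsts \<phi> = {}" "positive \<psi>" "fconsts \<psi> = {}"
  shows "BT s (FNot (neg cneg \<phi>) \<^bold>\<longrightarrow> neg cneg \<psi>)"
proof -
  have wf: "fm_in s \<phi>" "fm_in s \<psi>" using deriv_fm_in[OF assms(1)] by auto
  let ?\<Gamma> = "[\<phi>, FNot (neg cneg \<phi>)]"
  have "ent s ?\<Gamma> (neg cneg \<phi>)"
    using positive_neg_id(1) wf assms by (intro ent_mp[OF ent_thm ent_hyp]) auto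
  hence "ent s ?\<Gamma> FBot" by (rule ent_mp[rotated]) (simp add: ent_hyp)
  hence "BT s (FNot (neg cneg \<phi>) \<^bold>\<longrightarrow> FNot \<phi>)"
    using wf ent_impI by (simp add: BT_imp_iff)
  thus ?thesis using assms positive_neg_id(1) wf BT_trans by blast
qed

section \<open>Equality and combinatory axioms\<close>

fun leaves :: "xt \<Rightarrow> trm set" where
  "leaves (T a) = {a}"
| "leaves (t \<bullet> u) = leaves t \<union> leaves u"

lemma positive_ev [simp]: "positive (ev t x)"
  by (induction t x rule: ev.induct) (auto simp: Let_def)

lemma fconsts_ev [simp]: "fconsts (ev t x) = (\<Union>a\<in>leaves t. tconsts a)"
  by (induction t x rule: ev.induct) (auto simp: Let_def)

lemma positive_sim [simp]: "positive (sim t u)"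
  by (simp add: sim_def Let_def)

lemma fconsts_sim [simp]: "fconsts (sim t u) = (\<Union>a\<in>leaves t \<union> leaves u. tconsts a)"
  by (simp add: sim_def Let_def)

text \<open>Each of these axioms is positive or an implication between positive formulas, since
  \<open>eqv\<close> is itself positive.\<close>

lemma neg_equality_axiom:
  assumes "equality_axiom \<phi>" "fm_in s \<phi>"
  shows "BT s (neg cneg \<phi>)"
proof -
  have "positive \<phi> \<and> fconsts \<phi> = {} \<or>
    (\<exists>\<psi> \<chi>. \<phi> = (\<psi> \<^bold>\<longrightarrow> \<chi>) \<and> positive \<psi> \<and> fconsts \<psi> = {} \<and> positive \<chi> \<and> fconsts \<chi> = {})"
    using assms(1) by cases simp_all
  moreover have "BT s \<phi>" using assms by (rule equality)
  ultimately show ?thesis using BT_neg_imp BT_neg_positive by auto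
qed

lemma neg_combinatory_axiom:
  assumes "combinatory_axiom \<phi>" "fm_in s \<phi>"
  shows "BT s (neg cneg \<phi>)"
proof -
  have BT: "BT s \<phi>" using assms by (rule combinatory)
  show ?thesis using assms(1)
  proof cases
    \<comment> \<open>The one combinatory axiom with a universal quantifier, hidden in
      \<open>cong\<close>. The two implications under it are translated separately and generalized
      again.\<close>
    case (s x y z)
    define t where "t = xc cS \<bullet> xv x \<bullet> xv y \<bullet> xv z"
    define u where "u = xv x \<bullet> xv z \<bullet> (xv y \<bullet> xv z)"
    define w where "w = new (xfv t \<union> xfv u)"
    have c: "fconsts (ev t w) = {}" "fconsts (ev u w) = {}" by (simp_all add: t_def u_def del: ev.simps)
    have \<phi>: "\<phi> = FAll w (ev t w \<^bold>\<longleftrightarrow> ev u w)" using s by (simp add: cong_def t_def u_def w_def Let_def)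
    have w: "fst w = Ty 0" by (simp add: w_def)
    have "ent s [] (subst w (V w) (ev t w \<^bold>\<longleftrightarrow> ev u w))"
      using BT w unfolding \<phi> by (intro ent_allE) auto
    hence "ent s [] (ev t w \<^bold>\<longleftrightarrow> ev u w)" by simp
    hence "BT s (ev t w \<^bold>\<longrightarrow> ev u w)" "BT s (ev u w \<^bold>\<longrightarrow> ev t w)" unfolding ent_and_iff by simp_all
    hence "ent s [] (neg cneg (ev t w) \<^bold>\<longleftrightarrow> neg cneg (ev u w))"
      unfolding ent_and_iff ent_Nil using BT_neg_imp positive_ev c by blast
    hence "ent s [] (neg cneg (ev t w \<^bold>\<longleftrightarrow> ev u w))" by (simp only: neg.simps)
    thus ?thesis using w ent_allI[of s "[]" _ w] unfolding \<phi> by simp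
  next
    case (d_neq x y n m)
    show ?thesis unfolding d_neq(1) neg.simps(4,7)
      by (rule BT_neg_not_imp[OF BT[unfolded d_neq(1)]]) (simp_all del: ev.simps)
  next
    case (d_eq x y n m)
    show ?thesis unfolding d_eq(1) neg.simps(7)
      by (rule BT_neg_imp[OF BT[unfolded d_eq(1)]]) (simp_all del: ev.simps)
  next
    case (Ap_fun f x y z)
    show ?thesis unfolding Ap_fun(1) neg.simps(7)
      by (rule BT_neg_imp[OF BT[unfolded Ap_fun(1)]]) simp_all
  next
    \<comment> \<open>A negation is an implication to \<open>FBot\<close>, and \<open>FBot\<close>
      counts as positive.\<close>
    case (p_nonzero x y)
    show ?thesis unfolding p_nonzero(1) neg.simps(7)
      by (rule BT_neg_imp[OF BT[unfolded p_nonzero(1)]]) simp_all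
  qed (rule BT_neg_positive[OF BT]; simp add: defd_def Let_def del: ev.simps)+
qed

section \<open>Comprehension\<close>

fun map_xt :: "(trm \<Rightarrow> trm) \<Rightarrow> xt \<Rightarrow> xt" where
  "map_xt f (T a) = T (f a)"
| "map_xt f (t \<bullet> u) = map_xt f t \<bullet> map_xt f u"

context
  fixes f :: "trm \<Rightarrow> trm"
  assumes f_var: "f (V x) = V x" and f_type: "tyof (f a) = tyof a"
begin

lemma xfv_map_xt: "(\<And>a. a \<in> leaves t \<Longrightarrow> tv (f a) = tv a) \<Longrightarrow> xfv (map_xt f t) = xfv t"
  by (induction t) auto

text \<open>\<open>ev\<close> chooses its bound variables from the free variables of the term, so
  both sides agree literally only if the map preserves those.\<close>

lemma map_fm_ev:
  "(\<And>a. a \<in> leaves t \<Longrightarrow> tv (f a) = tv a) \<Longrightarrow> map_fm f (ev t x) = ev (map_xt f t) x"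
  by (induction t x rule: ev.induct) (auto simp: Let_def xfv_map_xt f_var f_type)

lemma map_fm_sim:
  assumes "\<And>a. a \<in> leaves t \<union> leaves u \<Longrightarrow> tv (f a) = tv a"
  shows "map_fm f (sim t u) = sim (map_xt f t) (map_xt f u)"
  using assms by (simp add: sim_def Let_def xfv_map_xt map_fm_ev)

lemma map_xt_xapp:
  assumes "f (Cst cP) = Cst cP"
  shows "map_xt f (xapp t us) = xapp (map_xt f t) (map (map_xt f) us)"
proof -
  have "map_xt f (foldl (\<lambda>a b. xc cP \<bullet> a \<bullet> b) u us) =
      foldl (\<lambda>a b. xc cP \<bullet> a \<bullet> b) (map_xt f u) (map (map_xt f) us)" for u us
    by (induction us arbitrary: u) (simp_all add: assms)
  thus ?thesis by (cases us) simp_all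
qed

end

lemma leaves_xapp: "leaves (xapp t us) \<subseteq> leaves t \<union> {Cst cP} \<union> (\<Union>u\<in>set us. leaves u)"
proof -
  have "leaves (foldl (\<lambda>a b. xc cP \<bullet> a \<bullet> b) u us) \<subseteq>
      leaves u \<union> {Cst cP} \<union> (\<Union>u\<in>set us. leaves u)" for u us
    by (induction us arbitrary: u) fastforce+
  thus ?thesis by (cases us) fastforce+
qed

lemma neg_comprehension_axiom:
  assumes "comprehension_axiom \<phi>" "fm_in s \<phi>"
  shows "BT s (neg cneg \<phi>)"
  using assms(1)
proof cases
  case (1 Z k U Xs \<chi> n)
  let ?n = "gn Z Xs (neg cneg \<chi>)" and ?v = "(Ty 0, 0)"
  let ?f = "ttrans cneg ?v"
  let ?A = "\<lambda>n. sim (xapp (xc (cC n)) (map xv Xs)) (xv U)"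
  let ?M = "Mem k (V Z) (V U)"
  \<comment> \<open>\<open>n\<close> is a genuine code, so its constant does not become 0 but the
    constant comprehending \<open>neg cneg \<chi>\<close>.\<close>
  have n: "cneg n = cC ?n"
    using 1 cneg_gn[of Z k "Suc k" \<chi> Xs] by (simp add: elementary_def neg_trans_def)
  have wf: "fm_in s (?A n)" "fm_in s ?M" "fm_in s \<chi>" "ty_le (fst Z) s" "ty_le (fst U) s"
    using assms(2) 1 by auto
  have leaves: "leaves (xapp (xc (cC n)) (map xv Xs)) \<subseteq> insert (Cst (cC n)) (insert (Cst cP) (V ` set Xs))" for n
    using leaves_xapp[of "xc (cC n)" "map xv Xs"] by auto
  have A: "map_fm ?f (?A n) = ?A ?n"
  proof (subst map_fm_sim)
    show "\<And>a. a \<in> leaves (xapp (xc (cC n)) (map xv Xs)) \<union> leaves (xv U) \<Longrightarrow> tv (?f a) = tv a"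
      using leaves[of n] n by auto
    show "sim (map_xt ?f (xapp (xc (cC n)) (map xv Xs))) (map_xt ?f (xv U)) = ?A ?n"
      by (simp add: map_xt_xapp n comp_def)
  qed simp_all
  have "fm_in s (?A ?n)" using wf(1) fm_in_map_fm[of ?f s "?A n"] by (simp add: A)
  hence "BT s (FEx U (?A ?n \<^bold>\<and> FAll Z (?M \<^bold>\<longleftrightarrow> neg cneg \<chi>)))"
    using 1 wf
    by (intro comprehension comprehension_axiom.intros elementary_neg) auto
  moreover have "BT s ((?A ?n \<^bold>\<and> FAll Z (?M \<^bold>\<longleftrightarrow> neg cneg \<chi>)) \<^bold>\<longrightarrow>
    (neg cneg (?A n) \<^bold>\<and> FAll Z (FNot (FNot ?M) \<^bold>\<longleftrightarrow> neg cneg \<chi>)))"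
  proof -
    have AA: "BT s (?A ?n \<^bold>\<longrightarrow> neg cneg (?A n))"
      using positive_neg[of "?A n" s ?v] wf n leaves[of n] unfolding A by fastforce
    let ?I = "?M \<^bold>\<longleftrightarrow> neg cneg \<chi>"
    have st: "stable s (neg cneg \<chi>)" using wf by (simp add: stable_neg)
    have I: "ent s [?I] (?M \<^bold>\<longleftrightarrow> neg cneg \<chi>)" by (rule ent_hyp) simp
    \<comment> \<open>Stability of the translated \<chi> allows the membership atom to be doubly
      negated inside the equivalence.\<close>
    have "ent s [?I] (FNot (FNot ?M) \<^bold>\<longleftrightarrow> neg cneg \<chi>)"
    proof (rule ent_iffI)
      fix \<Delta> assume \<Delta>: "set [?I] \<subseteq> set \<Delta>"
      have "ent s (?M # \<Delta>) (neg cneg \<chi>)"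
        using ent_iffD[OF I, of "?M # \<Delta>"] \<Delta> by (auto simp: ent_hyp)
      moreover have "ent s \<Delta> (neg cneg \<chi>) \<Longrightarrow> ent s \<Delta> (FNot (FNot ?M))"
        using ent_iffD[OF I \<Delta>] wf(2) ent_nnI by blast
      ultimately show "ent s \<Delta> (FNot (FNot ?M)) \<longleftrightarrow> ent s \<Delta> (neg cneg \<chi>)"
        using ent_nnE[of s \<Delta> ?M "neg cneg \<chi>"] wf(2) st by blast
    qed (use wf in auto)
    hence "BT s (?I \<^bold>\<longrightarrow> (FNot (FNot ?M) \<^bold>\<longleftrightarrow> neg cneg \<chi>))" using wf by (simp add: BT_imp_iff)
    hence MM: "BT s (FAll Z ?I \<^bold>\<longrightarrow> FAll Z (FNot (FNot ?M) \<^bold>\<longleftrightarrow> neg cneg \<chi>))"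
      using wf(4) by (rule BT_all_mono)
    let ?\<Gamma> = "[?A ?n \<^bold>\<and> FAll Z ?I]"
    have "ent s ?\<Gamma> (?A ?n \<^bold>\<and> FAll Z ?I)" by (rule ent_hyp) simp
    hence "ent s ?\<Gamma> (neg cneg (?A n) \<^bold>\<and> FAll Z (FNot (FNot ?M) \<^bold>\<longleftrightarrow> neg cneg \<chi>))"
      unfolding ent_and_iff[of s ?\<Gamma> "?A ?n"] ent_and_iff[of s ?\<Gamma> "neg cneg (?A n)"]
      using ent_mp[OF ent_thm[OF AA]] ent_mp[OF ent_thm[OF MM]] by blast
    thus ?thesis using deriv_fm_in[OF AA] deriv_fm_in[OF MM] by (simp add: BT_imp_iff)
  qed
  ultimately have "BT s (FEx U (neg cneg (?A n) \<^bold>\<and> FAll Z (FNot (FNot ?M) \<^bold>\<longleftrightarrow> neg cneg \<chi>)))"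
    using BT_ex_mono wf(5) MP by blast
  hence "BT s (FNot (FNot (FEx U (neg cneg (?A n) \<^bold>\<and> FAll Z (FNot (FNot ?M) \<^bold>\<longleftrightarrow> neg cneg \<chi>)))))"
    using BT_nnI deriv_fm_in MP by blast
  moreover have "neg cneg ?M = FNot (FNot ?M)"
    using neg_atomic_nonzero[of ?M cneg ?v] by simp
  ultimately show ?thesis unfolding 1(1) by simp
qed

section \<open>Quantifier rules\<close>

text \<open>Replacing \<open>x\<close> by the translated \<open>t\<close> merges the two assumptions
  on \<open>w\<close> and leaves \<open>G\<close> alone; the remaining assumptions only posit names,
  which \<open>BT_named\<close> provides. \<open>F\<close> collects what the names must
  avoid.\<close>

lemma neg_subst_elim:
  assumes t: "tyof t = fst x" "x \<notin> tv t" "ty_le (fst x) s" and G: "x \<notin> fv G" and F: "finite F"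
    and ent: "\<And>z w. fst z = Ty 0 \<Longrightarrow> fst w = Ty 0 \<Longrightarrow> z \<notin> F \<Longrightarrow> w \<notin> F \<Longrightarrow>
      ent s [Eq Om (V z) (Cst Zero), Eq (fst x) (V w) (V x), Eq (fst x) (V w) (ttrans cneg z t)] G"
  shows "BT s G"
proof -
  let ?F = "F \<union> fv G \<union> insert x (tv t)"
  obtain z where z: "fst z = Ty 0" "z \<notin> ?F" by (rule fresh_var[of ?F "Ty 0"]) (use F in auto)
  obtain w where w: "fst w = Ty 0" "w \<notin> insert z ?F"
    by (rule fresh_var[of "insert z ?F" "Ty 0"]) (use F in auto)
  let ?Z = "Eq Om (V z) (Cst Zero)" and ?t = "ttrans cneg z t"
  let ?X = "\<lambda>a. Eq (fst x) (V w) a"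
  have tz: "tv ?t \<subseteq> insert z (tv t)" using tv_ttrans[of cneg z t] by auto
  have ty: "tyof ?t = fst x" using z(1) t(1) by simp
  have "ent s [?X (V x), ?X ?t, ?Z] G" using ent[OF z(1) w(1)] z w by (auto elim!: ent_weaken)
  hence "ent s [?X ?t, ?Z] (?X (V x) \<^bold>\<longrightarrow> G)" using w t(3) by (intro ent_impI) auto
  hence "ent s [?X ?t, ?Z] (FAll x (?X (V x) \<^bold>\<longrightarrow> G))"
    using t(2,3) tz z w by (intro ent_allI) auto
  hence "ent s [?X ?t, ?Z] (subst x ?t (?X (V x) \<^bold>\<longrightarrow> G))"
    using ty G by (intro ent_allE) auto
  moreover have "x \<noteq> w" using w by auto
  ultimately have "ent s [?X ?t, ?Z] (?X ?t \<^bold>\<longrightarrow> G)" using G by simp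
  hence "ent s [?X ?t, ?Z] G" by (rule ent_mp) (simp add: ent_hyp)
  moreover have "BT s (FEx w (?X ?t))" using ty t(3) w tz by (intro BT_named) auto
  ultimately have "ent s [?Z] G" using w by (auto intro: ent_exE[OF ent_thm])
  moreover have "BT s (FEx z ?Z)" using z by (intro BT_named) auto
  ultimately show ?thesis using z ent_exE[of s "[]" z ?Z G] by auto
qed

lemma neg_AllE:
  assumes t: "tyof t = fst x" "free_for t x \<phi>" and wf: "fm_in s \<phi>" "ty_le (fst x) s"
  shows "BT s (FAll x (neg cneg \<phi>) \<^bold>\<longrightarrow> neg cneg (subst x t \<phi>))"
proof (cases "x \<in> tv t")
  case True
  \<comment> \<open>Terms are variables or constants, so the substitution is the identity here. The
    naming argument could leave \<open>x\<close> free in the conclusion.\<close>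
  hence [simp]: "t = V x" by (cases t) auto
  have "BT s (FAll x (neg cneg \<phi>) \<^bold>\<longrightarrow> subst x (V x) (neg cneg \<phi>))"
    using wf by (intro logic logic_axiom.AllE) auto
  thus ?thesis by simp
next
  case False
  show ?thesis
  proof (rule neg_subst_elim[OF t(1) False wf(2)])
    let ?F = "bv (neg cneg \<phi>) \<union> bv (neg cneg (subst x t \<phi>))"
    show "finite ?F" by simp
    \<comment> \<open>Bound on the left, replaced by \<open>t\<close> on the right.\<close>
    show "x \<notin> fv (FAll x (neg cneg \<phi>) \<^bold>\<longrightarrow> neg cneg (subst x t \<phi>))"
      using False fv_subst[of x t \<phi>] by auto
    fix z w assume zw: "fst z = Ty 0" "fst w = Ty 0" "z \<notin> ?F" "w \<notin> ?F"
    let ?\<Gamma> = "[Eq Om (V z) (Cst Zero), Eq (fst x) (V w) (V x), Eq (fst x) (V w) (ttrans cneg z t)]"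
    have iff: "ent s ?\<Gamma> (neg cneg \<phi> \<^bold>\<longleftrightarrow> neg cneg (subst x t \<phi>))"
      by (rule neg_subst[OF wf(1) t(2,1) False]) (use zw in auto)
    let ?\<Delta> = "FAll x (neg cneg \<phi>) # ?\<Gamma>"
    have "ent s ?\<Delta> (subst x (V x) (neg cneg \<phi>))"
      by (rule ent_allE) (auto intro: ent_hyp)
    hence "ent s ?\<Delta> (neg cneg (subst x t \<phi>))" using ent_iffD[OF iff, of ?\<Delta>] by auto
    thus "ent s ?\<Gamma> (FAll x (neg cneg \<phi>) \<^bold>\<longrightarrow> neg cneg (subst x t \<phi>))"
      using wf by (intro ent_impI) auto
  qed
qed

lemma neg_ExI:
  assumes t: "tyof t = fst x" "free_for t x \<phi>" and wf: "fm_in s \<phi>" "ty_le (fst x) s"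
  shows "BT s (neg cneg (subst x t \<phi>) \<^bold>\<longrightarrow> FEx x (neg cneg \<phi>))"
proof (cases "x \<in> tv t")
  case True
  hence [simp]: "t = V x" by (cases t) auto
  have "BT s (subst x (V x) (neg cneg \<phi>) \<^bold>\<longrightarrow> FEx x (neg cneg \<phi>))"
    using wf by (intro logic logic_axiom.ExI) auto
  thus ?thesis by simp
next
  case False
  show ?thesis
  proof (rule neg_subst_elim[OF t(1) False wf(2)])
    let ?F = "bv (neg cneg \<phi>) \<union> bv (neg cneg (subst x t \<phi>))"
    show "finite ?F" by simp
    show "x \<notin> fv (neg cneg (subst x t \<phi>) \<^bold>\<longrightarrow> FEx x (neg cneg \<phi>))"
      using False fv_subst[of x t \<phi>] by auto
    fix z w assume zw: "fst z = Ty 0" "fst w = Ty 0" "z \<notin> ?F" "w \<notin> ?F"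
    let ?\<Gamma> = "[Eq Om (V z) (Cst Zero), Eq (fst x) (V w) (V x), Eq (fst x) (V w) (ttrans cneg z t)]"
    have iff: "ent s ?\<Gamma> (neg cneg \<phi> \<^bold>\<longleftrightarrow> neg cneg (subst x t \<phi>))"
      by (rule neg_subst[OF wf(1) t(2,1) False]) (use zw in auto)
    let ?\<Delta> = "neg cneg (subst x t \<phi>) # ?\<Gamma>"
    have "ent s ?\<Delta> (neg cneg \<phi>)" using ent_iffD[OF iff, of ?\<Delta>] by (auto simp: ent_hyp)
    hence "ent s ?\<Delta> (FEx x (neg cneg \<phi>))"
      using wf(2) by (intro ent_exI[where t = "V x"]) auto
    thus "ent s ?\<Gamma> (neg cneg (subst x t \<phi>) \<^bold>\<longrightarrow> FEx x (neg cneg \<phi>))"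
      using wf t(1) by (intro ent_impI) auto
  qed
qed

section \<open>Induction\<close>

lemma fv_ev: "fv (ev t x) \<subseteq> insert x (xfv t)"
proof (induction t arbitrary: x)
  case (XApp t u)
  define y where "y = new (xfv t \<union> xfv u \<union> {x})"
  define z where "z = new (insert y (xfv t \<union> xfv u \<union> {x}))"
  have "ev (t \<bullet> u) x = FEx y (FEx z (ev t y \<^bold>\<and> ev u z \<^bold>\<and> Ap (V y) (V z) (V x)))"
    unfolding y_def z_def by (simp add: Let_def)
  thus ?case using XApp.IH(1)[of y] XApp.IH(2)[of z] by auto
qed simp

text \<open>Only terms all of whose parts have type \<open>0\<close> or \<open>\<omega>\<close> have a unique value: objects of
  type \<open>k \<ge> 1\<close> may have several names.\<close>

lemma ent_ev_unique:
  assumes "\<forall>a\<in>leaves t. tyof a = Om \<or> tyof a = Ty 0" "fst x = Ty 0" "fst x' = Ty 0"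
    "x \<notin> xfv t" "x' \<notin> fv (ev t x) \<union> bv (ev t x)"
  shows "ent s [ev t x, subst x (V x') (ev t x)] (Eq (Ty 0) (V x) (V x'))"
  using assms
proof (induction t arbitrary: x x')
  case (T a)
  let ?\<Gamma> = "[Eq (tyof a) (V x) a, Eq (tyof a) (V x') a]"
  have *: "ent s ?\<Gamma> (Eq (tyof a) (V x) a)" "ent s ?\<Gamma> (Eq (tyof a) (V x') a)"
    by (simp_all add: ent_hyp)
  have "ent s ?\<Gamma> (Eq (Ty 0) (V x) (V x'))"
  proof (cases "tyof a = Om")
    case True
    thus ?thesis using * ent_num_eq by simp
  next
    case False
    hence a: "tyof a = Ty 0" using T by auto
    have "ent s ?\<Gamma> (Eq (Ty 0) (V x') (V x'))" using T by (intro ent_refl) simp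
    thus ?thesis unfolding a by (rule ent_eq_eq[OF *(2,1)[unfolded a]])
  qed
  thus ?case using T by simp
next
  case (XApp t u)
  define A where "A = xfv t \<union> xfv u \<union> {x}"
  define y where "y = new A"
  define z where "z = new (insert y A)"
  have y: "fst y = Ty 0" "y \<notin> A" and z: "fst z = Ty 0" "z \<notin> insert y A"
    using new_notin[of A] new_notin[of "insert y A"] unfolding y_def z_def by (simp_all add: A_def)
  let ?E = "\<lambda>x. FEx y (FEx z (ev t y \<^bold>\<and> ev u z \<^bold>\<and> Ap (V y) (V z) (V x)))"
  have ev: "ev (t \<bullet> u) x = ?E x"
    unfolding y_def z_def A_def by (simp add: Let_def)
  have x': "x' \<noteq> y" "x' \<noteq> z" using XApp.prems(5) unfolding ev by auto
  have "x \<notin> fv (ev t y)" "x \<notin> fv (ev u z)"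
    using y z fv_ev[of t y] fv_ev[of u z] XApp.prems(4) by (auto simp: A_def)
  hence ev': "subst x (V x') (ev (t \<bullet> u) x) = ?E x'"
    using y z unfolding ev by (auto simp: A_def)
  \<comment> \<open>Both evaluations bind the same \<open>y\<close> and \<open>z\<close>; the
    witnesses of the second are renamed so that they can be compared with those of the
    first.\<close>
  let ?F = "{x, x', y, z} \<union> fv (ev t y) \<union> fv (ev u z) \<union> bv (ev t y) \<union> bv (ev u z)"
  obtain y' where y': "fst y' = Ty 0" "y' \<notin> ?F" by (rule fresh_var[of ?F "Ty 0"]) auto
  obtain z' where z': "fst z' = Ty 0" "z' \<notin> insert y' ?F"
    by (rule fresh_var[of "insert y' ?F" "Ty 0"]) auto
  let ?B = "ev t y \<^bold>\<and> ev u z \<^bold>\<and> Ap (V y) (V z) (V x)"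
  let ?t' = "subst y (V y') (ev t y)" and ?u' = "subst z (V z') (ev u z)"
  let ?B' = "?t' \<^bold>\<and> ?u' \<^bold>\<and> Ap (V y') (V z') (V x')"
  let ?C' = "FEx z (?t' \<^bold>\<and> ev u z \<^bold>\<and> Ap (V y') (V z) (V x'))"
  let ?\<Delta> = "[?B, FEx z ?B, ?E x, ?E x']"
  have t': "fv ?t' \<subseteq> insert y' (fv (ev t y))" using fv_subst[of y "V y'" "ev t y"] by auto
  have "y \<notin> fv (ev u z)" using y z fv_ev[of u z] by (auto simp: A_def)
  hence C': "subst y (V y') (FEx z (ev t y \<^bold>\<and> ev u z \<^bold>\<and> Ap (V y) (V z) (V x'))) = ?C'"
    using y z x' by (auto simp: A_def)
  have "z \<notin> fv ?t'" using t' fv_ev[of t y] y' z by (auto simp: A_def)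
  hence B': "subst z (V z') (?t' \<^bold>\<and> ev u z \<^bold>\<and> Ap (V y') (V z) (V x')) = ?B'"
    using y' x' by auto
  have "ent s (?B' # ?C' # ?\<Delta>) (Eq (Ty 0) (V x) (V x'))"
  proof -
    let ?\<Theta> = "?B' # ?C' # ?\<Delta>"
    have "ent s ?\<Theta> ?B" "ent s ?\<Theta> ?B'" by (rule ent_hyp; simp)+
    hence h: "ent s ?\<Theta> (ev t y)" "ent s ?\<Theta> (ev u z)" "ent s ?\<Theta> (Ap (V y) (V z) (V x))"
      "ent s ?\<Theta> ?t'" "ent s ?\<Theta> ?u'" "ent s ?\<Theta> (Ap (V y') (V z') (V x'))"
      by (simp_all add: ent_and_iff)
    have cut: "ent s ?\<Theta> \<gamma>" if "ent s ?\<Theta> \<alpha>" "ent s ?\<Theta> \<beta>" "ent s [\<alpha>, \<beta>] \<gamma>" for \<alpha> \<beta> \<gamma>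
    proof -
      have "ent s (\<alpha> # \<beta> # ?\<Theta>) \<gamma>" using that(3) by (rule ent_weaken) auto
      with ent_weaken1[OF that(1)] have "ent s (\<beta> # ?\<Theta>) \<gamma>" by (rule ent_cut)
      with that(2) show ?thesis by (rule ent_cut)
    qed
    \<comment> \<open>The induction hypotheses identify functions and arguments; congruence and
      single-valuedness of \<open>Ap\<close> then identify the results.\<close>
    have "ent s ?\<Theta> (Eq (Ty 0) (V y) (V y'))"
      using XApp.prems y y' by (intro cut[OF h(1,4)] XApp.IH(1)) (auto simp: A_def)
    moreover have "ent s ?\<Theta> (Eq (Ty 0) (V z) (V z'))"
      using XApp.prems z z' by (intro cut[OF h(2,5)] XApp.IH(2)) (auto simp: A_def)
    moreover have "ent s ?\<Theta> (Eq (Ty 0) (V x) (V x))"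
      using XApp.prems by (intro ent_refl) simp
    ultimately have "ent s ?\<Theta> (Ap (V y') (V z') (V x))" using h(3) ent_Ap_cong by blast
    thus ?thesis using h(6) by (rule ent_Ap_fun)
  qed
  hence "ent s (?C' # ?\<Delta>) (Eq (Ty 0) (V x) (V x'))"
    unfolding B'[symmetric]
    by (rule ent_exE_rename[OF ent_hyp, rotated]) (use y' z' z t' x' in auto)
  hence "ent s ?\<Delta> (Eq (Ty 0) (V x) (V x'))"
    unfolding C'[symmetric]
    by (rule ent_exE_rename[OF ent_hyp, rotated]) (use y' y z x' in auto)
  hence "ent s [FEx z ?B, ?E x, ?E x'] (Eq (Ty 0) (V x) (V x'))"
    by (rule ent_exE[OF ent_hyp, rotated]) (use z x' in \<open>auto simp: A_def\<close>)
  hence "ent s [?E x, ?E x'] (Eq (Ty 0) (V x) (V x'))"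
    by (rule ent_exE[OF ent_hyp, rotated]) (use y x' in \<open>auto simp: A_def\<close>)
  thus ?case unfolding ev' unfolding ev .
qed

text \<open>\<open>new\<close> searches among type-0 variables only. Hence
  \<open>sim t (xv m)\<close> binds the same variable for every numerical \<open>m\<close>.\<close>

lemma new_num: "fst m = Om \<Longrightarrow> new (A \<union> {m}) = new A"
  unfolding new_def by (rule arg_cong[where f = "\<lambda>P. (Ty 0, LEAST i. P i)"]) auto

text \<open>The value of \<open>t\<close> is unique and names both numbers, so it is the common name
  that \<open>eqv\<close> asks for.\<close>

lemma ent_sim_num_unique:
  assumes "\<forall>a\<in>leaves t. tyof a = Om \<or> tyof a = Ty 0" "fst m = Om" "fst m' = Om"
  shows "ent s [sim t (xv m), sim t (xv m')] (eqv m m')"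
proof -
  define u where "u = new (xfv t)"
  have u: "fst u = Ty 0" "u \<notin> xfv t" unfolding u_def by (simp, rule new_notin, simp)
  have um: "u \<noteq> m" "u \<noteq> m'" using u assms by auto
  let ?B = "\<lambda>m. ev t u \<^bold>\<and> Eq Om (V u) (V m)"
  have sim: "sim t (xv m) = FEx u (?B m)" "sim t (xv m') = FEx u (?B m')"
    using assms unfolding sim_def Let_def u_def by (simp_all add: new_num[of _ "xfv t", simplified])
  let ?F = "{u, m, m'} \<union> fv (ev t u) \<union> bv (ev t u) \<union> fv (eqv m m')"
  obtain v where v: "fst v = Ty 0" "v \<notin> ?F" by (rule fresh_var[of ?F "Ty 0"]) auto
  let ?B' = "subst u (V v) (ev t u) \<^bold>\<and> Eq Om (V v) (V m')"
  let ?\<Delta> = "[?B m, FEx u (?B m), FEx u (?B m')]"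
  have "fv (eqv m m') \<subseteq> {m, m'}" unfolding sim_def Let_def by auto
  hence ueq: "u \<notin> fv (eqv m m')" using um by auto
  have "ent s (?B' # ?\<Delta>) (eqv m m')"
  proof -
    let ?\<Theta> = "?B' # ?\<Delta>"
    have "ent s ?\<Theta> (?B m)" "ent s ?\<Theta> ?B'" by (rule ent_hyp; simp)+
    hence h: "ent s ?\<Theta> (ev t u)" "ent s ?\<Theta> (Eq Om (V u) (V m))"
      "ent s ?\<Theta> (subst u (V v) (ev t u))" "ent s ?\<Theta> (Eq Om (V v) (V m'))"
      by (simp_all add: ent_and_iff)
    have "ent s [ev t u, subst u (V v) (ev t u)] (Eq (Ty 0) (V u) (V v))"
      using assms u v by (intro ent_ev_unique) auto
    hence "ent s (ev t u # subst u (V v) (ev t u) # ?\<Theta>) (Eq (Ty 0) (V u) (V v))"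
      by (rule ent_weaken) auto
    hence "ent s ?\<Theta> (Eq (Ty 0) (V u) (V v))"
      using ent_cut h(1,3) ent_weaken1 by blast
    hence "ent s ?\<Theta> (Eq Om (V v) (V m))" using h(2) ent_eq_num by blast
    thus ?thesis using h(4) assms v by (intro ent_eqv[where w = v]) auto
  qed
  hence "ent s ?\<Delta> (eqv m m')"
    using um u v by (intro ent_exE_rename[of s ?\<Delta> u "?B m'" v, OF ent_hyp]) auto
  hence "ent s [FEx u (?B m), FEx u (?B m')] (eqv m m')"
    by (rule ent_exE[OF ent_hyp, rotated]) (use um ueq in auto)
  thus ?thesis unfolding sim .
qed

text \<open>The name \<open>w\<close> can be kept apart from the context, whereas \<open>eqv\<close>
  fixes its bound variable from \<open>m\<close> and \<open>m'\<close> alone.\<close>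

lemma ent_eqvE:
  assumes "ent s \<Gamma> (eqv m m')" "ent s (Eq (fst m) (V w) (V m) # Eq (fst m') (V w) (V m') # \<Gamma>) G"
    "fst w = Ty 0" "w \<notin> {m, m'} \<union> bv (eqv m m')" "w \<notin> fv (Conj \<Gamma>)" "w \<notin> fv G"
  shows "ent s \<Gamma> G"
proof -
  let ?B = "\<lambda>w. Eq (fst m) (V w) (V m) \<^bold>\<and> Eq (fst m') (V w) (V m')"
  define w0 where "w0 = new {m, m'}"
  have w0: "fst w0 = Ty 0" "w0 \<notin> {m, m'}" unfolding w0_def by (simp, rule new_notin, simp)
  have B: "subst w0 (V w) (?B w0) = ?B w" using w0 by auto
  have ex: "ent s \<Gamma> (FEx w0 (?B w0))" and bv: "w \<noteq> w0"
    using assms(1,4) unfolding w0_def sim_def Let_def by (simp_all add: insert_commute)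
  have "ent s (?B w # \<Gamma>) (?B w)" by (simp add: ent_hyp)
  hence h: "ent s (?B w # \<Gamma>) (Eq (fst m) (V w) (V m))" "ent s (?B w # \<Gamma>) (Eq (fst m') (V w) (V m'))"
    by (simp_all add: ent_and_iff)
  have "ent s (Eq (fst m) (V w) (V m) # Eq (fst m') (V w) (V m') # ?B w # \<Gamma>) G"
    using assms(2) by (rule ent_weaken) auto
  hence "ent s (subst w0 (V w) (?B w0) # \<Gamma>) G"
    unfolding B using ent_cut[OF h(2)] ent_cut[OF ent_weaken1[OF h(1)]] by blast
  with ex show ?thesis
    by (rule ent_exE_rename) (use assms(3-6) w0 bv in auto)
qed

text \<open>The induction rule for \<open>neg cneg \<phi>\<close> asks for the instance of the
  translation, while the hypothesis gives the translation of the instance; common names link the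
  two.\<close>

lemma neg_subst_zero:
  assumes "BT s (neg cneg (subst n (Cst Zero) \<phi>))" "fst n = Om"
  shows "BT s (subst n (Cst Zero) (neg cneg \<phi>))"
proof -
  let ?F = "insert n (bv (neg cneg \<phi>) \<union> bv (neg cneg (subst n (Cst Zero) \<phi>)) \<union> fv \<phi>)"
  obtain z where z: "fst z = Ty 0" "z \<notin> ?F" by (rule fresh_var[of ?F "Ty 0"]) auto
  obtain w where w: "fst w = Ty 0" "w \<notin> insert z ?F"
    by (rule fresh_var[of "insert z ?F" "Ty 0"]) auto
  let ?Z = "Eq Om (V z) (Cst Zero)" and ?W = "\<lambda>a. Eq Om (V w) a"
  have wf: "fm_in s \<phi>" using deriv_fm_in[OF assms(1)] assms(2) by simp
  have "ent s [?Z, Eq (fst n) (V w) (V n), Eq (fst n) (V w) (ttrans cneg z (Cst Zero))]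
    (neg cneg \<phi> \<^bold>\<longleftrightarrow> neg cneg (subst n (Cst Zero) \<phi>))"
    by (rule neg_subst[OF wf]) (use assms(2) z w in \<open>auto intro!: free_for_bv\<close>)
  hence "ent s [?W (V n), ?W (Cst Zero), ?Z] (neg cneg \<phi>)"
    using ent_iffD[of s _ "neg cneg \<phi>" _ "[?W (V n), ?W (Cst Zero), ?Z]"] ent_thm[OF assms(1)] assms(2)
    by (auto simp: insert_commute)
  hence "ent s [] (?Z \<^bold>\<longrightarrow> ?W (Cst Zero) \<^bold>\<longrightarrow> ?W (V n) \<^bold>\<longrightarrow> neg cneg \<phi>)"
    using assms(2) z w by (intro ent_impI) auto
  \<comment> \<open>Putting 0 for \<open>n\<close> turns the assumption that \<open>w\<close> names
    \<open>n\<close> into one that \<open>w\<close> names 0, and such a name exists.\<close>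
  hence "BT s (subst n (Cst Zero) (?Z \<^bold>\<longrightarrow> ?W (Cst Zero) \<^bold>\<longrightarrow> ?W (V n) \<^bold>\<longrightarrow> neg cneg \<phi>))"
    using assms(2) by (intro BT_subst free_for_bv) auto
  moreover have "n \<noteq> z" "n \<noteq> w" using z w by auto
  ultimately have "BT s (?Z \<^bold>\<longrightarrow> ?W (Cst Zero) \<^bold>\<longrightarrow> ?W (Cst Zero) \<^bold>\<longrightarrow> subst n (Cst Zero) (neg cneg \<phi>))"
    by simp
  from ent_thm[OF this] have "ent s [?W (Cst Zero), ?Z] (subst n (Cst Zero) (neg cneg \<phi>))"
    by (rule ent_mp[OF ent_mp[OF ent_mp]]) (auto intro: ent_hyp)
  moreover have fresh: "z \<notin> fv (subst n (Cst Zero) (neg cneg \<phi>))" "w \<notin> fv (subst n (Cst Zero) (neg cneg \<phi>))"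
    using fv_subst[of n "Cst Zero" "neg cneg \<phi>"] z w by auto
  moreover have "BT s (FEx w (?W (Cst Zero)))" using w by (intro BT_named) auto
  ultimately have "ent s [?Z] (subst n (Cst Zero) (neg cneg \<phi>))"
    using w by (auto intro: ent_exE[OF ent_thm])
  moreover have "BT s (FEx z ?Z)" using z by (intro BT_named) auto
  ultimately show ?thesis using z fresh ent_exE[of s "[]" z ?Z] by auto
qed

text \<open>In the induction, \<open>m\<close> is the successor from the translated premise and
  \<open>l\<close> the one from the axiom. If \<open>w\<close> names \<open>n\<close> and
  \<open>m\<close>, \<open>neg_subst\<close> leads from the instance at \<open>m\<close> to
  \<open>neg cneg \<phi>\<close>; putting \<open>l\<close> for \<open>n\<close> makes
  \<open>w\<close> a common name of \<open>l\<close> and \<open>m\<close>, as \<open>eqv l m\<close>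
  provides.\<close>

lemma neg_subst_num:
  assumes "fst n = Om" "fst m = Om" "m \<noteq> n" "free_for (V m) n \<phi>" "fm_in s \<phi>"
    "fst l = Om" "l \<notin> bv (neg cneg \<phi>) \<union> {n, m}"
  shows "ent s [eqv l m, neg cneg (subst n (V m) \<phi>)] (subst n (V l) (neg cneg \<phi>))"
proof -
  let ?K = "neg cneg (subst n (V m) \<phi>)" and ?G = "subst n (V l) (neg cneg \<phi>)"
  let ?F = "{n, l, m} \<union> bv (neg cneg \<phi>) \<union> bv ?K \<union> bv (eqv l m) \<union> fv ?K \<union> fv ?G"
  obtain z where z: "fst z = Ty 0" "z \<notin> ?F" by (rule fresh_var[of ?F "Ty 0"]) auto
  obtain w where w: "fst w = Ty 0" "w \<notin> insert z ?F"
    by (rule fresh_var[of "insert z ?F" "Ty 0"]) auto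
  let ?Z = "Eq Om (V z) (Cst Zero)" and ?W = "\<lambda>a. Eq Om (V w) a"
  have nK: "n \<notin> fv ?K" using fv_subst[of n "V m" \<phi>] assms(3) by auto
  have "ent s [?Z, Eq (fst n) (V w) (V n), Eq (fst n) (V w) (ttrans cneg z (V m))]
    (neg cneg \<phi> \<^bold>\<longleftrightarrow> ?K)"
    by (rule neg_subst[OF assms(5,4)]) (use assms z w in auto)
  hence "ent s [?K, ?W (V m), ?W (V n), ?Z] (neg cneg \<phi>)"
    using ent_iffD[of s _ "neg cneg \<phi>" _ "[?K, ?W (V m), ?W (V n), ?Z]"] assms(1)
    by (auto simp: ent_hyp)
  hence "ent s [] (?Z \<^bold>\<longrightarrow> ?W (V n) \<^bold>\<longrightarrow> ?W (V m) \<^bold>\<longrightarrow> ?K \<^bold>\<longrightarrow> neg cneg \<phi>)"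
    using assms z w by (intro ent_impI) auto
  hence "BT s (subst n (V l) (?Z \<^bold>\<longrightarrow> ?W (V n) \<^bold>\<longrightarrow> ?W (V m) \<^bold>\<longrightarrow> ?K \<^bold>\<longrightarrow> neg cneg \<phi>))"
    using assms nK by (intro BT_subst) (auto intro: free_for_bv)
  moreover have "n \<noteq> z" "n \<noteq> w" using z w by auto
  ultimately have "BT s (?Z \<^bold>\<longrightarrow> ?W (V l) \<^bold>\<longrightarrow> ?W (V m) \<^bold>\<longrightarrow> ?K \<^bold>\<longrightarrow> ?G)"
    using nK assms(3) by simp
  hence "BT s (FEx z ?Z \<^bold>\<longrightarrow> ?W (V l) \<^bold>\<longrightarrow> ?W (V m) \<^bold>\<longrightarrow> ?K \<^bold>\<longrightarrow> ?G)"
    by (rule ExE) (use z w in auto)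
  moreover have "BT s (FEx z ?Z)" using z by (intro BT_named) auto
  ultimately have "BT s (?W (V l) \<^bold>\<longrightarrow> ?W (V m) \<^bold>\<longrightarrow> ?K \<^bold>\<longrightarrow> ?G)" by (rule MP)
  from ent_thm[OF this]
  have "ent s (?W (V l) # ?W (V m) # [eqv l m, ?K]) ?G"
    by (rule ent_mp[OF ent_mp[OF ent_mp]]) (auto intro: ent_hyp)
  moreover have "w \<notin> fv (eqv l m)" using w by (auto simp: sim_def Let_def)
  ultimately show ?thesis
    using assms w by (intro ent_eqvE[of s "[eqv l m, ?K]" l m w, OF ent_hyp]) auto
qed

lemma neg_induction:
  assumes zero: "BT s (neg cneg (subst n (Cst Zero) \<phi>))"
    and suc: "BT s (neg cneg
      (\<phi> \<^bold>\<longrightarrow> FEx m (sim (xc cP \<bullet> xv n \<bullet> xc Zero) (xv m) \<^bold>\<and> subst n (V m) \<phi>)))"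
    and n: "fst n = Om" and m: "fst m = Om" "m \<noteq> n" "m \<notin> fv \<phi>" "free_for (V m) n \<phi>"
  shows "BT s (neg cneg \<phi>)"
proof -
  have wf: "fm_in s \<phi>" using deriv_fm_in[OF zero] n by simp
  let ?t = "xc cP \<bullet> xv n \<bullet> xc Zero"
  let ?F = "{n, m} \<union> bv (neg cneg \<phi>) \<union> fv \<phi>"
  \<comment> \<open>\<open>l\<close> will be the successor given by \<open>p_num\<close>; avoiding
    the bound variables of the translation makes it free for \<open>n\<close> there.\<close>
  obtain l where l: "fst l = Om" "l \<notin> ?F" by (rule fresh_var[of ?F Om]) auto
  let ?S = "\<lambda>m. sim ?t (xv m)"
  let ?K = "neg cneg (subst n (V m) \<phi>)" and ?G = "subst n (V l) (neg cneg \<phi>)"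
  have fvS: "fv (?S m) \<subseteq> {n, m}" for m
    unfolding sim_def Let_def fv.simps using fv_ev[of ?t] by fastforce
  have numS: "BT s (FEx m (?S m))" if "fst m = Om" "m \<noteq> n" for m
  proof -
    have "fm_in s (ev t x)" if "\<forall>a\<in>leaves t. ty_le (tyof a) s" "fst x = Ty 0" for t x
      using that by (induction t x rule: ev.induct) (auto simp: Let_def)
    hence "fm_in s (FEx m (?S m))" using n that unfolding sim_def Let_def by (simp del: ev.simps(2))
    thus ?thesis using n that by (intro combinatory combinatory_axiom.p_num)
  qed
  have wfS: "fm_in s (?S m)" if "fst m = Om" "m \<noteq> n" for m
    using deriv_fm_in[OF numS[OF that]] by simp
  have K: "fm_in s ?K" using wf m n by simp
  have "BT s (FNot (FNot (neg cneg \<phi>)) \<^bold>\<longrightarrow> neg cneg \<phi>)"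
    using stable_neg[OF wf] by (simp add: stable_def)
  \<comment> \<open>\<open>?G\<close> is an instance of a translation and not presented as one, so
    its stability is inherited by substitution.\<close>
  hence "BT s (subst n (V l) (FNot (FNot (neg cneg \<phi>)) \<^bold>\<longrightarrow> neg cneg \<phi>))"
    using l n by (intro BT_subst free_for_bv) auto
  hence st: "stable s ?G" using wf l n by (simp add: stable_def)
  have eq: "ent s [?S m, ?S l, ?K] ?G"
  proof -
    have "ent s [?S l, ?S m] (eqv l m)" using l m n by (intro ent_sim_num_unique) auto
    hence "ent s [?S m, ?S l, ?K] (eqv l m)" by (rule ent_weaken) auto
    moreover have "ent s [eqv l m, ?K] ?G"
      using l m n wf by (intro neg_subst_num) auto
    hence "ent s (eqv l m # [?S m, ?S l, ?K]) ?G" by (rule ent_weaken) auto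
    ultimately show ?thesis by (rule ent_cut)
  qed
  let ?E = "FEx m (neg cneg (?S m) \<^bold>\<and> ?K)"
  have "ent s [neg cneg (?S m) \<^bold>\<and> ?K, ?E, ?S l] ?G"
  proof -
    let ?\<Delta> = "[neg cneg (?S m) \<^bold>\<and> ?K, ?E, ?S l]"
    have "ent s ?\<Delta> (neg cneg (?S m) \<^bold>\<and> ?K)" by (simp add: ent_hyp)
    hence h: "ent s ?\<Delta> (neg cneg (?S m))" "ent s ?\<Delta> ?K" by (simp_all add: ent_and_iff)
    have "BT s (neg cneg (?S m) \<^bold>\<longrightarrow> FNot (FNot (?S m)))"
      using wfS[OF m(1,2)] by (intro positive_neg_id(2)) simp_all
    hence nn: "ent s ?\<Delta> (FNot (FNot (?S m)))" using h(1) ent_thm ent_mp by blast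
    have "ent s (?K # ?S m # ?\<Delta>) ?G" using eq by (rule ent_weaken) auto
    with ent_weaken1[OF h(2)] have "ent s (?S m # ?\<Delta>) ?G" by (rule ent_cut)
    with nn show ?thesis using wfS[OF m(1,2)] st by (rule ent_nnE)
  qed
  moreover have mG: "m \<notin> fv ?G" using fv_subst[of n "V l" "neg cneg \<phi>"] m l by auto
  moreover have "m \<notin> fv (?S l)" using fvS[of l] m l by auto
  ultimately have "ent s [?E, ?S l] ?G"
    by (intro ent_exE[of s "[?E, ?S l]" m "neg cneg (?S m) \<^bold>\<and> ?K", OF ent_hyp]) auto
  hence "ent s (?E # [?S l, neg cneg \<phi>]) ?G" by (rule ent_weaken) auto
  moreover have "ent s [?S l, neg cneg \<phi>] (FNot (FNot ?E))"
    using suc by (intro ent_mp[OF ent_thm ent_hyp[of "neg cneg \<phi>"]]) (simp_all add: sim_def)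
  moreover have "fm_in s ?E" using wfS m K by simp
  ultimately have "ent s [?S l, neg cneg \<phi>] ?G" using st ent_nnE by blast
  hence "ent s [?S l, neg cneg \<phi>] (?S l \<^bold>\<and> ?G)" by (simp add: ent_and_iff ent_hyp)
  hence "ent s [?S l, neg cneg \<phi>] (FEx l (?S l \<^bold>\<and> ?G))"
    using l by (intro ent_exI[where t = "V l"]) auto
  \<comment> \<open>\<open>p_num\<close> provides the successor outright, so the existential comes
    without a double negation, as the induction rule demands.\<close>
  hence "ent s [neg cneg \<phi>] (FEx l (?S l \<^bold>\<and> ?G))"
    using numS[of l] l by (intro ent_exE[of s "[neg cneg \<phi>]" l "?S l", OF ent_thm]) auto
  hence "BT s (neg cneg \<phi> \<^bold>\<longrightarrow> FEx l (?S l \<^bold>\<and> ?G))" using wf by (simp add: BT_imp_iff)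
  from deriv.induction[OF neg_subst_zero[OF zero n] this n l(1)] l
  show ?thesis using free_for_bv[of "V l" "neg cneg \<phi>"] by simp
qed

section \<open>Logical axioms, excluded middle and the rules\<close>

lemma neg_logic_axiom:
  assumes "logic_axiom \<phi>" "fm_in s \<phi>"
  shows "BT s (neg cneg \<phi>)"
  using assms
proof cases
  case (OrI1 \<phi> \<psi>)
  thus ?thesis using assms(2) BT_trans[OF logic[OF logic_axiom.OrI1] BT_nnI] by simp
next
  case (OrI2 \<psi> \<phi>)
  thus ?thesis using assms(2) BT_trans[OF logic[OF logic_axiom.OrI2] BT_nnI] by simp
next
  case (OrE \<phi> \<chi> \<psi>)
  let ?A = "neg cneg \<phi>" and ?B = "neg cneg \<psi>" and ?C = "neg cneg \<chi>"
  have wf: "fm_in s \<phi>" "fm_in s \<psi>" "fm_in s \<chi>" using assms(2) OrE by auto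
  let ?\<Gamma> = "[FNot (FNot (?A \<^bold>\<or> ?B)), ?B \<^bold>\<longrightarrow> ?C, ?A \<^bold>\<longrightarrow> ?C]"
  have "ent s (?A # (?A \<^bold>\<or> ?B) # ?\<Gamma>) ?C" "ent s (?B # (?A \<^bold>\<or> ?B) # ?\<Gamma>) ?C"
    by (rule ent_mp[OF ent_hyp[of "?A \<^bold>\<longrightarrow> ?C"] ent_hyp], simp, simp,
        rule ent_mp[OF ent_hyp[of "?B \<^bold>\<longrightarrow> ?C"] ent_hyp], simp, simp)
  hence "ent s ((?A \<^bold>\<or> ?B) # ?\<Gamma>) ?C" by (rule ent_orE[rotated]) (simp add: ent_hyp)
  hence "ent s ?\<Gamma> ?C"
    by (rule ent_nnE[rotated]) (use wf stable_neg[OF wf(3)] in \<open>auto intro: ent_hyp\<close>)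
  hence "ent s [] ((?A \<^bold>\<longrightarrow> ?C) \<^bold>\<longrightarrow> (?B \<^bold>\<longrightarrow> ?C) \<^bold>\<longrightarrow> FNot (FNot (?A \<^bold>\<or> ?B)) \<^bold>\<longrightarrow> ?C)"
    using wf by (intro ent_impI) auto
  thus ?thesis using OrE by simp
next
  case (AllE t x \<phi>)
  thus ?thesis using assms(2) neg_AllE by simp
next
  case (ExI t x \<phi>)
  have "BT s (neg cneg (subst x t \<phi>) \<^bold>\<longrightarrow> FEx x (neg cneg \<phi>))"
    using ExI assms(2) by (intro neg_ExI) auto
  moreover have "BT s (FEx x (neg cneg \<phi>) \<^bold>\<longrightarrow> FNot (FNot (FEx x (neg cneg \<phi>))))"
    using ExI assms(2) by (intro BT_nnI) auto
  ultimately show ?thesis using ExI BT_trans by simp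
\<comment> \<open>The remaining schemas involve no disjunction, existential or substitution, so they
  are translated into instances of themselves.\<close>
qed (use assms(2) in \<open>auto intro!: logic logic_axiom.intros\<close>)

text \<open>Taken at \<open>neg cneg \<phi>\<close>, this is literally the translation of excluded
  middle for \<phi>.\<close>

lemma BT_neg_classical:
  assumes "fm_in s \<phi>"
  shows "BT s (FNot (FNot (\<phi> \<^bold>\<or> FNot \<phi>)))"
proof -
  let ?N = "FNot (\<phi> \<^bold>\<or> FNot \<phi>)"
  have "ent s [\<phi>, ?N] (\<phi> \<^bold>\<or> FNot \<phi>)" using assms by (intro ent_orI1 ent_hyp) auto
  hence "ent s [\<phi>, ?N] FBot" by (rule ent_mp[rotated]) (simp add: ent_hyp)
  hence "ent s [?N] (FNot \<phi>)" using assms by (intro ent_impI)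
  hence "ent s [?N] (\<phi> \<^bold>\<or> FNot \<phi>)" using assms by (rule ent_orI2)
  hence "ent s [?N] FBot" by (rule ent_mp[rotated]) (simp add: ent_hyp)
  thus ?thesis using assms by (simp add: BT_imp_iff)
qed

lemma BT_neg: "deriv cl s \<phi> \<Longrightarrow> BT s (neg cneg \<phi>)"
proof (induction rule: deriv.induct)
  case (logic \<phi>)
  thus ?case by (rule neg_logic_axiom)
next
  case (classical \<phi>)
  thus ?case using BT_neg_classical[of s "neg cneg \<phi>"] by simp
next
  case (MP \<phi> \<psi>)
  thus ?case using deriv.MP by simp
next
  case (AllI \<psi> \<phi> x)
  thus ?case by (simp add: deriv.AllI)
next
  case (ExE \<phi> \<psi> x)
  have wf: "fm_in s \<phi>" "fm_in s \<psi>" using deriv_fm_in[OF ExE.hyps(1)] by auto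
  have "BT s (FEx x (neg cneg \<phi>) \<^bold>\<longrightarrow> neg cneg \<psi>)"
    using ExE by (intro deriv.ExE) auto
  \<comment> \<open>The translated antecedent is a doubly negated existential; the stable consequent
    absorbs the double negation.\<close>
  hence "BT s (FNot (FNot (FEx x (neg cneg \<phi>))) \<^bold>\<longrightarrow> FNot (FNot (neg cneg \<psi>)))"
    by (rule BT_nn_mono)
  moreover have "BT s (FNot (FNot (neg cneg \<psi>)) \<^bold>\<longrightarrow> neg cneg \<psi>)"
    using stable_neg[OF wf(2)] by (simp add: stable_def)
  ultimately have "BT s (FNot (FNot (FEx x (neg cneg \<phi>))) \<^bold>\<longrightarrow> neg cneg \<psi>)" by (rule BT_trans)
  thus ?case by simp
next
  case (equality \<phi>)
  thus ?case by (rule neg_equality_axiom)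
next
  case (combinatory \<phi>)
  thus ?case by (rule neg_combinatory_axiom)
next
  case (comprehension \<phi>)
  thus ?case by (rule neg_comprehension_axiom)
next
  case (induction n \<phi> m)
  show ?case by (rule neg_induction[OF induction.IH induction.hyps(3-7)])
qed

theorem theorem9:
  fixes s :: nat and \<psi> :: fm
  assumes "fm_in s \<psi>" and "BTcl s \<psi>"
  shows "BT s (neg_trans \<psi>)"
  using BT_neg[OF assms(2)] by (simp add: neg_trans_def)

end
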